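(* Let $\kappa$ be inaccessible and let $f\in\kappa^\kappa$ be strictly increasing with $f(0)>1$. Then $PT_f$, equipped with the relations $\le_i$ ($i<\kappa$), is strongly $\kappa^\kappa$-bounding.
   Context: $PT_f$ is the set of $p\subseteq\kappa^{<\kappa}$ such that: $p\ne\emptyset$ is a tree; $\eta(i)<f(i)$ for $\eta\in p$, $i\in\mathrm{dom}(\eta)$; each $\eta\in p$ has either exactly one immediate successor in $p$ or $\mathrm{succ}_p(\eta)=\{\eta^\frown\alpha\colon\alpha<f(\mathrm{dom}\,\eta)\}$; every $\eta\in p$ extends to some $\nu\in p$ with $|\mathrm{succ}_p(\nu)|>1$; for limit $\lambda<\kappa$ and $\eta\in\kappa^\lambda$, $\eta\in p$ iff $\eta\restriction i\in p$ for all $i<\lambda$; for limit $\lambda$ and $\eta\in p\cap\kappa^\lambda$, if $\{\nu\subsetneq\eta\colon|\mathrm{succ}_p(\nu)|>1\}$ is unbounded in $\eta$ then $|\mathrm{succ}_p(\eta)|>1$. $q\le p$ iff $q\subseteq p$. $\mathrm{split}_p(\eta)$ means $|\mathrm{succ}_p(\eta)|>1$; $\mathrm{ht}_p(\eta)=\mathrm{otp}\{\nu\subsetneq\eta\colon\mathrm{split}_p(\nu)\}$; $\mathrm{split}_i(p)=\{\eta\in p\colon\mathrm{split}_p(\eta)\wedge\mathrm{ht}_p(\eta)=i\}$. $q\le_i p$ iff $q\le p$ and $\mathrm{split}_i(p)\subseteq q$. A forcing $P$ is strongly $\kappa^\kappa$-bounding if there is a sequence $(\le_i)_{i<\kappa}$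 of reflexive transitive relations on $P$ such that: $(P,\le)$ is ${<}\kappa$-closed; $\le_i\subseteq\le$; $\le_i\subseteq\le_j$ for $j<i$; for every fusion sequence $(p_j)_{j<\mu}$ with $\mu\le\kappa$ (i.e. $p_{j+1}\le_j p_j$ for all $j$ with $j+1<\mu$, and $p_\lambda\le_j p_j$ for limit $\lambda<\mu$ and $j<\lambda$) there is $q_\mu$ with $q_\mu\le_j p_j$ for all $j<\mu$; and for every maximal antichain $A$, every $p\in P$ and $i<\kappa$ there is $q\le_i p$ such that $\{r\in A\colon r\text{ compatible with }q\}$ has size $<\kappa$. *)

theory Defs
  imports Main
begin

unbundle cardinal_syntax

text \<open>
  The cardinal \<open>\<kappa>\<close> is the order type of a well-ordered type \<open>'k\<close>: the ordinals below \<open>\<kappa>\<close> are the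
  elements of \<open>'k\<close>, and an ordinal \<open>a < \<kappa>\<close> corresponds to the initial segment \<open>{..<a}\<close>.
\<close>

definition ord_rel :: "'k::wellorder rel" where
  "ord_rel = {(a, b). a \<le> b}"

definition inaccessible :: "'k rel \<Rightarrow> bool" where
  "inaccessible r \<longleftrightarrow>
     Card_order r \<and> natLeq <o r \<and> regularCard r \<and>
     (\<forall>A. A \<subseteq> Field r \<and> |A| <o r \<longrightarrow> |Pow A| <o r)"

definition ozero :: "'k::wellorder" where
  "ozero = (LEAST a. True)"

definition osucc :: "'k::wellorder \<Rightarrow> 'k" where
  "osucc a = (LEAST b. a < b)"

definition olimit :: "'k::wellorder \<Rightarrow> bool" where
  "olimit l \<longleftrightarrow> l \<noteq> ozero \<and> (\<forall>a<l. osucc a < l)"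


text \<open>Sequences of length \<open>a < \<kappa>\<close> are partial maps with domain \<open>{..<a}\<close>; extension is \<open>\<subseteq>\<^sub>m\<close>.\<close>

type_synonym 'k node = "'k \<rightharpoonup> 'k"

definition seqs_len :: "'k::wellorder \<Rightarrow> 'k node set" where
  "seqs_len a = {\<eta>. dom \<eta> = {..<a}}"

definition seqs :: "'k::wellorder node set" where
  "seqs = (\<Union>a. seqs_len a)"

definition len :: "'k::wellorder node \<Rightarrow> 'k" where
  "len \<eta> = (THE a. dom \<eta> = {..<a})"

definition snoc :: "'k::wellorder node \<Rightarrow> 'k \<Rightarrow> 'k node" where
  "snoc \<eta> \<alpha> = \<eta>(len \<eta> \<mapsto> \<alpha>)"

definition proper_init :: "'k node \<Rightarrow> 'k node \<Rightarrow> bool" where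
  "proper_init \<nu> \<eta> \<longleftrightarrow> \<nu> \<subseteq>\<^sub>m \<eta> \<and> \<nu> \<noteq> \<eta>"

definition is_tree :: "'k::wellorder node set \<Rightarrow> bool" where
  "is_tree p \<longleftrightarrow> p \<subseteq> seqs \<and> (\<forall>\<eta>\<in>p. \<forall>\<nu>\<in>seqs. \<nu> \<subseteq>\<^sub>m \<eta> \<longrightarrow> \<nu> \<in> p)"

definition succs :: "'k::wellorder node set \<Rightarrow> 'k node \<Rightarrow> 'k node set" where
  "succs p \<eta> = {\<nu> \<in> p. \<exists>\<alpha>. \<nu> = snoc \<eta> \<alpha>}"

text \<open>Not stated with \<^const>\<open>card\<close>, which is 0 on infinite sets.\<close>

definition splits :: "'k::wellorder node set \<Rightarrow> 'k node \<Rightarrow> bool" where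
  "splits p \<eta> \<longleftrightarrow> (\<exists>\<nu>\<in>succs p \<eta>. \<exists>\<nu>'\<in>succs p \<eta>. \<nu> \<noteq> \<nu>')"

definition splits_below :: "'k::wellorder node set \<Rightarrow> 'k node \<Rightarrow> 'k node set" where
  "splits_below p \<eta> = {\<nu> \<in> p. proper_init \<nu> \<eta> \<and> splits p \<nu>}"

definition PT :: "('k::wellorder \<Rightarrow> 'k) \<Rightarrow> 'k node set set" where
  "PT f = {p. p \<noteq> {} \<and> is_tree p \<and>
     (\<forall>\<eta>\<in>p. \<forall>i\<in>dom \<eta>. the (\<eta> i) < f i) \<and>
     (\<forall>\<eta>\<in>p. (\<exists>!\<nu>. \<nu> \<in> succs p \<eta>) \<or> succs p \<eta> = {snoc \<eta> \<alpha> |\<alpha>. \<alpha> < f (len \<eta>)}) \<and>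
     (\<forall>\<eta>\<in>p. \<exists>\<nu>\<in>p. \<eta> \<subseteq>\<^sub>m \<nu> \<and> splits p \<nu>) \<and>
     (\<forall>l. olimit l \<longrightarrow> (\<forall>\<eta>\<in>seqs_len l. \<eta> \<in> p \<longleftrightarrow> (\<forall>i<l. \<eta> |` {..<i} \<in> p))) \<and>
     (\<forall>l. olimit l \<longrightarrow> (\<forall>\<eta>\<in>p \<inter> seqs_len l.
        (\<forall>i<l. \<exists>\<nu>\<in>splits_below p \<eta>. i < len \<nu>) \<longrightarrow> splits p \<eta>))}"

text \<open>
  The order type of \<open>splits_below p \<eta>\<close> under \<open>\<subseteq>\<^sub>m\<close>: the ordinal \<open>i < \<kappa>\<close> whose initial segment
  \<open>{..<i}\<close> is isomorphic to it.
\<close>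

definition ht :: "'k::wellorder node set \<Rightarrow> 'k node \<Rightarrow> 'k" where
  "ht p \<eta> = (THE i.
     {(\<nu>, \<nu>'). \<nu> \<in> splits_below p \<eta> \<and> \<nu>' \<in> splits_below p \<eta> \<and> \<nu> \<subseteq>\<^sub>m \<nu>'}
       =o {(a, b). a \<le> b \<and> b < i})"

definition split_level :: "'k::wellorder \<Rightarrow> 'k node set \<Rightarrow> 'k node set" where
  "split_level i p = {\<eta> \<in> p. splits p \<eta> \<and> ht p \<eta> = i}"

definition PT_le :: "'k node set \<Rightarrow> 'k node set \<Rightarrow> bool" where
  "PT_le q p \<longleftrightarrow> q \<subseteq> p"

definition PT_le_at :: "'k::wellorder \<Rightarrow> 'k node set \<Rightarrow> 'k node set \<Rightarrow> bool" where
  "PT_le_at i q p \<longleftrightarrow> PT_le q p \<and> split_level i p \<subseteq> q"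


definition forcing :: "'p set \<Rightarrow> ('p \<Rightarrow> 'p \<Rightarrow> bool) \<Rightarrow> bool" where
  "forcing P le \<longleftrightarrow> P \<noteq> {} \<and> reflp_on P le \<and> transp_on P le"

definition compatible :: "'p set \<Rightarrow> ('p \<Rightarrow> 'p \<Rightarrow> bool) \<Rightarrow> 'p \<Rightarrow> 'p \<Rightarrow> bool" where
  "compatible P le p q \<longleftrightarrow> (\<exists>r\<in>P. le r p \<and> le r q)"

definition antichain :: "'p set \<Rightarrow> ('p \<Rightarrow> 'p \<Rightarrow> bool) \<Rightarrow> 'p set \<Rightarrow> bool" where
  "antichain P le A \<longleftrightarrow> A \<subseteq> P \<and> (\<forall>p\<in>A. \<forall>q\<in>A. p \<noteq> q \<longrightarrow> \<not> compatible P le p q)"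

definition maximal_antichain :: "'p set \<Rightarrow> ('p \<Rightarrow> 'p \<Rightarrow> bool) \<Rightarrow> 'p set \<Rightarrow> bool" where
  "maximal_antichain P le A \<longleftrightarrow>
     antichain P le A \<and> (\<forall>B. antichain P le B \<and> A \<subseteq> B \<longrightarrow> B = A)"

text \<open>
  The argument of type \<^typ>\<open>'k itself\<close> determines \<open>\<kappa>\<close>.
\<close>

definition lt_closed :: "'k::wellorder itself \<Rightarrow> 'p set \<Rightarrow> ('p \<Rightarrow> 'p \<Rightarrow> bool) \<Rightarrow> bool" where
  "lt_closed _ P le \<longleftrightarrow>
     (\<forall>(\<mu>::'k) p. (\<forall>j<\<mu>. p j \<in> P) \<and> (\<forall>i j. i < j \<and> j < \<mu> \<longrightarrow> le (p j) (p i)) \<longrightarrow>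
        (\<exists>q\<in>P. \<forall>j<\<mu>. le q (p j)))"

text \<open>Sequences of length \<open>\<mu> \<le> \<kappa>\<close> are indexed by \<open>{..<\<mu>}\<close> if \<open>\<mu> < \<kappa>\<close> and by \<open>UNIV\<close> if \<open>\<mu> = \<kappa>\<close>.\<close>

definition le_kappa_index :: "'k::wellorder set \<Rightarrow> bool" where
  "le_kappa_index I \<longleftrightarrow> I = UNIV \<or> (\<exists>\<mu>. I = {..<\<mu>})"

definition fusion_seq ::
  "'p set \<Rightarrow> ('k::wellorder \<Rightarrow> 'p \<Rightarrow> 'p \<Rightarrow> bool) \<Rightarrow> 'k set \<Rightarrow> ('k \<Rightarrow> 'p) \<Rightarrow> bool" where
  "fusion_seq P lei I p \<longleftrightarrow>
     (\<forall>j\<in>I. p j \<in> P) \<and>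
     (\<forall>j. osucc j \<in> I \<longrightarrow> lei j (p (osucc j)) (p j)) \<and>
     (\<forall>l\<in>I. olimit l \<longrightarrow> (\<forall>j<l. lei j (p l) (p j)))"

text \<open>
  \<open>P\<close> is strongly \<open>\<kappa>\<^sup>\<kappa>\<close>-bounding if this holds for some sequence \<open>lei\<close>; here the witnessing
  sequence is kept as an argument.
\<close>

definition strongly_bounding_via ::
  "'p set \<Rightarrow> ('p \<Rightarrow> 'p \<Rightarrow> bool) \<Rightarrow> ('k::wellorder \<Rightarrow> 'p \<Rightarrow> 'p \<Rightarrow> bool) \<Rightarrow> bool" where
  "strongly_bounding_via P le lei \<longleftrightarrow>
     forcing P le \<and>
     (\<forall>i. reflp_on P (lei i) \<and> transp_on P (lei i)) \<and>
     lt_closed TYPE('k) P le \<and>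
     (\<forall>i. \<forall>p\<in>P. \<forall>q\<in>P. lei i q p \<longrightarrow> le q p) \<and>
     (\<forall>i j. j < i \<longrightarrow> (\<forall>p\<in>P. \<forall>q\<in>P. lei i q p \<longrightarrow> lei j q p)) \<and>
     (\<forall>I p. le_kappa_index I \<and> fusion_seq P lei I p \<longrightarrow> (\<exists>q\<in>P. \<forall>j\<in>I. lei j q (p j))) \<and>
     (\<forall>A. maximal_antichain P le A \<longrightarrow>
        (\<forall>p\<in>P. \<forall>i. \<exists>q\<in>P. lei i q p \<and> |{r \<in> A. compatible P le r q}| <o |UNIV :: 'k set| ))"

end

theory Submission
  imports Defs
begin

text \<open>
  A node that does not split has a unique successor, so every branch of length \<open>\<kappa>\<close> through a
  condition runs through its splitting nodes, whose levels form a club. Hence every node lies below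
  nodes of every larger splitting height, and \<open>q \<le>\<^sub>i p\<close> means that \<open>q \<subseteq> p\<close> keeps all nodes of \<open>p\<close> of
  height at most \<open>i\<close>. In the intersection of a decreasing sequence of fewer than \<open>\<kappa>\<close> conditions,
  splitting nodes are found by intersecting the clubs along a branch; in a fusion sequence of length
  \<open>\<kappa>\<close> they are preserved explicitly.

  For the antichain condition, a node of splitting height \<open>i\<close> is coded by its choices at the splitting
  nodes below it, so by inaccessibility there are fewer than \<open>\<kappa>\<close> immediate successors \<open>\<sigma>\<close> of such
  nodes. Shrinking \<open>p\<close> above each \<open>\<sigma>\<close> to a condition below some element of the antichain gives
  \<open>q \<le>\<^sub>i p\<close>. Any condition below \<open>q\<close> contains one of the \<open>\<sigma>\<close>, so \<open>q\<close> is compatible only with the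
  chosen elements.
\<close>

section \<open>Sequences\<close>

text \<open>The dichotomy between one successor and all of them governs intersections: in a chain,
  the successor sets of a node are all full, or some member has a single successor and every smaller
  member shares it. So density of splitting nodes is the only clause of \<open>PT\<close> that an
  intersection of a chain can lose. Fewer than \<kappa> clubs have a common element, reached in
  \<omega> steps because \<kappa> is uncountable. The intersection of \<kappa> many clubs can be
  empty, which is why a sequence of length \<kappa> needs the promise made by fusion. A second
  obstacle is that heights depend on the tree. The level \<open>split_level i\<close> of a condition
  and of a smaller one are different sets in general, so the definition of the orderings through
  levels is not visibly transitive. Passing to all nodes of bounded height repairs this, because a
  node can only lose height when the tree shrinks.\<close>

lemma len_eqI: "dom \<eta> = {..<a} \<Longrightarrow> len \<eta> = a"
  unfolding len_def by (rule the_equality) auto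

lemma seqsI: "dom \<eta> = {..<a} \<Longrightarrow> \<eta> \<in> seqs"
  by (auto simp: seqs_def seqs_len_def)

lemma dom_seqs: "\<eta> \<in> seqs \<Longrightarrow> dom \<eta> = {..<len \<eta>}"
  by (auto simp: seqs_def seqs_len_def dest: len_eqI)

lemma seqs_len_iff: "\<eta> \<in> seqs_len a \<longleftrightarrow> \<eta> \<in> seqs \<and> len \<eta> = a"
  by (auto simp: seqs_def seqs_len_def dest: len_eqI)

lemma restrict_map_le: "\<eta> |` A \<subseteq>\<^sub>m \<eta>"
  by (auto simp: map_le_def)

lemma dom_restrict_lessThan:
  fixes a :: "'k::wellorder"
  assumes "{..<a} \<subseteq> dom \<eta>"
  shows "dom (\<eta> |` {..<a}) = {..<a}"
  using assms by auto

lemma seqs_restrict: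
  assumes "\<eta> \<in> seqs" "a \<le> len \<eta>"
  shows "\<eta> |` {..<a} \<in> seqs" "len (\<eta> |` {..<a}) = a"
proof -
  have "dom (\<eta> |` {..<a}) = {..<a}"
    using assms dom_seqs[OF assms(1)] by (intro dom_restrict_lessThan) auto
  then show "\<eta> |` {..<a} \<in> seqs" "len (\<eta> |` {..<a}) = a"
    by (rule seqsI, rule len_eqI)
qed

lemma restrict_len [simp]: "\<eta> \<in> seqs \<Longrightarrow> \<eta> |` {..<len \<eta>} = \<eta>"
  using dom_seqs[of \<eta>] by (auto simp: restrict_map_def fun_eq_iff domIff set_eq_iff)

lemma init_eq_restrict:
  assumes "\<nu> \<in> seqs" "\<nu> \<subseteq>\<^sub>m \<eta>"
  shows "\<nu> = \<eta> |` {..<len \<nu>}"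
proof
  fix x
  show "\<nu> x = (\<eta> |` {..<len \<nu>}) x"
    using assms(2) dom_seqs[OF assms(1)] by (cases "x < len \<nu>") (auto simp: map_le_def)
qed

lemma init_len_le:
  assumes "\<nu> \<in> seqs" "\<eta> \<in> seqs" "\<nu> \<subseteq>\<^sub>m \<eta>"
  shows "len \<nu> \<le> len \<eta>"
proof -
  have "{..<len \<nu>} \<subseteq> {..<len \<eta>}"
    using assms map_le_implies_dom_le dom_seqs by metis
  then show ?thesis by simp
qed

lemma restrict_le_restrict:
  fixes a :: "'k::wellorder"
  shows "a \<le> b \<Longrightarrow> \<eta> |` {..<a} \<subseteq>\<^sub>m \<eta> |` {..<b}"
  by (auto simp: map_le_def)

text \<open>Here \<eta> is an arbitrary partial map, since it will also be a branch of length
  \<kappa>, which lies outside \<open>seqs\<close>.\<close>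

lemma init_comparable:
  assumes "\<nu> \<in> seqs" "\<nu>' \<in> seqs" "\<nu> \<subseteq>\<^sub>m \<eta>" "\<nu>' \<subseteq>\<^sub>m \<eta>" "len \<nu> \<le> len \<nu>'"
  shows "\<nu> \<subseteq>\<^sub>m \<nu>'"
  using init_eq_restrict[OF assms(1,3)] init_eq_restrict[OF assms(2,4)]
    restrict_le_restrict[OF assms(5), of \<eta>] by simp

lemma init_len_eq:
  assumes "\<nu> \<in> seqs" "\<nu>' \<in> seqs" "\<nu> \<subseteq>\<^sub>m \<eta>" "\<nu>' \<subseteq>\<^sub>m \<eta>" "len \<nu> = len \<nu>'"
  shows "\<nu> = \<nu>'"
  using init_eq_restrict[OF assms(1,3)] init_eq_restrict[OF assms(2,4)] assms(5) by simp

lemma proper_init_iff: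
  assumes "\<nu> \<in> seqs" "\<eta> \<in> seqs"
  shows "proper_init \<nu> \<eta> \<longleftrightarrow> \<nu> \<subseteq>\<^sub>m \<eta> \<and> len \<nu> < len \<eta>"
  using assms init_len_le[OF assms] init_len_eq[OF assms, of \<eta>]
  by (auto simp: proper_init_def order.order_iff_strict)

lemma is_tree_seqs: "is_tree p \<Longrightarrow> \<eta> \<in> p \<Longrightarrow> \<eta> \<in> seqs"
  by (auto simp: is_tree_def)

lemma is_tree_init: "is_tree p \<Longrightarrow> \<eta> \<in> p \<Longrightarrow> \<nu> \<in> seqs \<Longrightarrow> \<nu> \<subseteq>\<^sub>m \<eta> \<Longrightarrow> \<nu> \<in> p"
  by (auto simp: is_tree_def)

lemma is_tree_restrict:
  assumes "is_tree p" "\<eta> \<in> p"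
  shows "\<eta> |` {..<a} \<in> p"
proof (cases "a \<le> len \<eta>")
  case True
  then show ?thesis
    using assms is_tree_init is_tree_seqs restrict_map_le seqs_restrict(1) by metis
next
  case False
  then have "dom \<eta> \<subseteq> {..<a}" using dom_seqs[OF is_tree_seqs[OF assms]] by auto
  then have "\<eta> |` {..<a} = \<eta>" by (metis map_le_implies_dom_le restrict_map_le map_le_antisym map_le_def dom_restrict
        inf.absorb1 restrict_in subsetD)
  then show ?thesis using assms by simp
qed

section \<open>Heights of nodes\<close>

lemma splits_below_iff:
  assumes "is_tree p" "\<eta> \<in> seqs"
  shows "\<nu> \<in> splits_below p \<eta> \<longleftrightarrow> \<nu> \<in> p \<and> \<nu> \<subseteq>\<^sub>m \<eta> \<and> len \<nu> < len \<eta> \<and> splits p \<nu>"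
  using assms proper_init_iff is_tree_seqs by (auto simp: splits_below_def)

section \<open>Initial segments of \<kappa> as order types\<close>

lemma Field_ord_rel [simp]: "Field ord_rel = UNIV"
  by (auto simp: ord_rel_def Field_def)

lemma Well_order_ord_rel: "Well_order (ord_rel :: 'k::wellorder rel)"
proof -
  have "ord_rel - Id = {(a, b :: 'k). a < b}" by (auto simp: ord_rel_def)
  moreover have "linear_order (ord_rel :: 'k rel)"
    by (auto simp: ord_rel_def linear_order_on_def partial_order_on_def preorder_on_def
        refl_on_def trans_def antisym_def total_on_def)
  ultimately show ?thesis
    by (simp add: well_order_on_def wf)
qed

lemma Restr_ord_rel: "Restr ord_rel {..<i} = {(a, b). a \<le> b \<and> b < i}"
  by (auto simp: ord_rel_def)

lemma underS_ord_rel: "underS ord_rel i = {..<i}"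
  by (auto simp: ord_rel_def underS_def)

lemma Field_seg: "Field {(a, b :: 'k::wellorder). a \<le> b \<and> b < i} = {..<i}"
  by (auto simp: Field_def)

lemma Well_order_seg: "Well_order {(a, b :: 'k::wellorder). a \<le> b \<and> b < i}"
  unfolding Restr_ord_rel[symmetric] by (rule Well_order_Restr[OF Well_order_ord_rel])

text \<open>A well-order is not isomorphic to a proper initial segment of itself. This is the
  uniqueness on which the \<open>THE\<close> in \<open>ht\<close> relies.\<close>

lemma seg_ordIso_unique:
  fixes i j :: "'k::wellorder"
  assumes "{(a, b). a \<le> b \<and> b < i} =o {(a, b). a \<le> b \<and> b < j}"
  shows "i = j"
proof -
  have *: "\<not> a < b" if "{(x, y). x \<le> y \<and> y < a} =o {(x, y). x \<le> y \<and> y < b}" for a b :: 'k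
  proof
    assume "a < b"
    have "Restr (Restr ord_rel {..<b}) (underS (Restr ord_rel {..<b}) a) <o Restr ord_rel {..<b}"
    proof (rule underS_Restr_ordLess[OF Well_order_Restr[OF Well_order_ord_rel]])
      show "Field (Restr ord_rel {..<b}) \<noteq> {}"
        unfolding Restr_ord_rel Field_seg using \<open>a < b\<close> by auto
    qed
    moreover have "underS (Restr ord_rel {..<b}) a = {..<a}"
      using \<open>a < b\<close> by (auto simp: ord_rel_def underS_def)
    moreover have "Restr (Restr ord_rel {..<b}) {..<a} = Restr ord_rel {..<a}"
      using \<open>a < b\<close> by (auto simp: ord_rel_def)
    ultimately show False
      using that by (simp add: Restr_ord_rel not_ordLess_ordIso)
  qed
  show ?thesis using *[OF assms] *[OF ordIso_symmetric[OF assms]] by simp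
qed

text \<open>The \<open>THE\<close> in \<open>ht\<close> is evaluated through this rule only. Since
  \<open>ht\<close> compares reflexive relations, the segment below \<open>i\<close> is carried
  along the inverse of \<open>g\<close>, and its image is exactly extension on
  \<open>splits_below p \<eta>\<close>.\<close>

lemma ht_eqI:
  fixes i :: "'k::wellorder"
  assumes "bij_betw g (splits_below p \<eta>) {..<i}"
    and "\<And>\<nu> \<nu>'. \<nu> \<in> splits_below p \<eta> \<Longrightarrow> \<nu>' \<in> splits_below p \<eta> \<Longrightarrow> \<nu> \<subseteq>\<^sub>m \<nu>' \<longleftrightarrow> g \<nu> \<le> g \<nu>'"
  shows "ht p \<eta> = i"
proof -
  let ?S = "splits_below p \<eta>"
  let ?R = "{(\<nu>, \<nu>'). \<nu> \<in> ?S \<and> \<nu>' \<in> ?S \<and> \<nu> \<subseteq>\<^sub>m \<nu>'}"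
  let ?h = "inv_into ?S g"
  have inj: "inj_on g ?S" and im: "g ` ?S = {..<i}"
    using assms(1) by (auto simp: bij_betw_def)
  have "inj_on ?h (Field {(a, b). a \<le> b \<and> b < i})"
    unfolding Field_seg im[symmetric] by (rule inj_on_inv_into) simp
  then have "{(a, b). a \<le> b \<and> b < i} =o dir_image {(a, b). a \<le> b \<and> b < i} ?h"
    by (intro dir_image_ordIso Well_order_seg)
  moreover have "dir_image {(a, b). a \<le> b \<and> b < i} ?h = ?R"
  proof (intro set_eqI iffI)
    fix x assume "x \<in> dir_image {(a, b). a \<le> b \<and> b < i} ?h"
    then obtain a b where ab: "a \<le> b" "b < i" "x = (?h a, ?h b)"
      by (auto simp: dir_image_def)
    then have "a \<in> g ` ?S" "b \<in> g ` ?S" using im by auto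
    then have "?h a \<in> ?S" "?h b \<in> ?S" "g (?h a) = a" "g (?h b) = b"
      by (simp_all only: inv_into_into f_inv_into_f)
    then show "x \<in> ?R" using ab assms(2)[of "?h a" "?h b"] by simp
  next
    fix x assume "x \<in> ?R"
    then obtain \<nu> \<nu>' where x: "\<nu> \<in> ?S" "\<nu>' \<in> ?S" "\<nu> \<subseteq>\<^sub>m \<nu>'" "x = (\<nu>, \<nu>')" by auto
    then have "(g \<nu>, g \<nu>') \<in> {(a, b). a \<le> b \<and> b < i}"
      using assms(2)[of \<nu> \<nu>'] im by auto
    then have "(?h (g \<nu>), ?h (g \<nu>')) \<in> dir_image {(a, b). a \<le> b \<and> b < i} ?h"
      unfolding dir_image_def by blast
    then show "x \<in> dir_image {(a, b). a \<le> b \<and> b < i} ?h"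
      using x inv_into_f_f[OF inj] by simp
  qed
  ultimately have *: "?R =o {(a, b). a \<le> b \<and> b < i}"
    using ordIso_symmetric by (simp only:)
  show ?thesis
    unfolding ht_def
  proof (rule the_equality)
    show "?R =o {(a, b). a \<le> b \<and> b < i}" by (rule *)
    fix j :: 'k assume "?R =o {(a, b). a \<le> b \<and> b < j}"
    then show "j = i"
      using seg_ordIso_unique[OF ordIso_transitive[OF ordIso_symmetric[OF *]]] by simp
  qed
qed

text \<open>By induction on the length, \<open>ht p\<close> itself is the order isomorphism from \<open>splits_below p \<eta>\<close>
  onto an initial segment of \<open>\<kappa>\<close>.\<close>

lemma ht_image_splits_below_aux:
  assumes "is_tree p" "\<eta> \<in> seqs"
  shows "ht p ` splits_below p \<eta> = {..<ht p \<eta>} \<and> ht p \<eta> \<le> len \<eta>"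
  using assms(2)
proof (induction "len \<eta>" arbitrary: \<eta> rule: less_induct)
  case less
  let ?S = "splits_below p \<eta>"
  have S: "\<nu> \<in> p" "\<nu> \<in> seqs" "\<nu> \<subseteq>\<^sub>m \<eta>" "len \<nu> < len \<eta>" "splits p \<nu>" if "\<nu> \<in> ?S" for \<nu>
    using that splits_below_iff[OF assms(1) less.prems] is_tree_seqs[OF assms(1)] by blast+
  have IH: "ht p ` splits_below p \<nu> = {..<ht p \<nu>}" "ht p \<nu> \<le> len \<nu>" if "\<nu> \<in> ?S" for \<nu>
    using less.hyps[of \<nu>] S[OF that] by blast+
  have mono: "ht p \<nu> < ht p \<nu>'" if "\<nu> \<in> ?S" "\<nu>' \<in> ?S" "len \<nu> < len \<nu>'" for \<nu> \<nu>'
  proof -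
    have "\<nu> \<subseteq>\<^sub>m \<nu>'"
      using init_comparable[OF S(2)[OF that(1)] S(2)[OF that(2)] S(3)[OF that(1)] S(3)[OF that(2)]]
        that(3) by simp
    then have "\<nu> \<in> splits_below p \<nu>'"
      using S[OF that(1)] S[OF that(2)] that(3) splits_below_iff[OF assms(1)] by blast
    then show ?thesis using IH(1)[OF that(2)] by blast
  qed
  have ord: "\<nu> \<subseteq>\<^sub>m \<nu>' \<longleftrightarrow> ht p \<nu> \<le> ht p \<nu>'" if "\<nu> \<in> ?S" "\<nu>' \<in> ?S" for \<nu> \<nu>'
  proof
    assume "\<nu> \<subseteq>\<^sub>m \<nu>'"
    then have "len \<nu> \<le> len \<nu>'" using S(2)[OF that(1)] S(2)[OF that(2)] by (intro init_len_le)
    moreover have "\<nu> = \<nu>'" if "len \<nu> = len \<nu>'"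
      using init_len_eq[OF S(2)[OF \<open>\<nu> \<in> ?S\<close>] S(2)[OF \<open>\<nu>' \<in> ?S\<close>]
          S(3)[OF \<open>\<nu> \<in> ?S\<close>] S(3)[OF \<open>\<nu>' \<in> ?S\<close>] that] .
    ultimately show "ht p \<nu> \<le> ht p \<nu>'"
      using mono[OF that] by (cases "len \<nu> = len \<nu>'") (simp, simp add: order.order_iff_strict)
  next
    assume "ht p \<nu> \<le> ht p \<nu>'"
    then have "len \<nu> \<le> len \<nu>'" using mono[OF that(2,1)] by (meson not_le)
    then show "\<nu> \<subseteq>\<^sub>m \<nu>'" 
      using init_comparable[OF S(2)[OF that(1)] S(2)[OF that(2)] S(3)[OF that(1)] S(3)[OF that(2)]]
      by simp
  qed
  have inj: "inj_on (ht p) ?S"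
    by (intro inj_onI map_le_antisym) (simp_all add: ord)
  have bd: "ht p \<nu> < len \<eta>" if "\<nu> \<in> ?S" for \<nu>
    using IH(2)[OF that] S(4)[OF that] by order
  \<comment> \<open>By the induction hypothesis each height that occurs brings along all smaller
    ones, so the heights below \<eta> fill the segment up to the least value missed. Some value is
    missed, namely \<open>len \<eta>\<close>, which also yields the bound.\<close>
  define i where "i = (LEAST i. i \<notin> ht p ` ?S)"
  have "len \<eta> \<notin> ht p ` ?S" using bd by (metis imageE less_irrefl)
  then have i: "i \<notin> ht p ` ?S" "i \<le> len \<eta>"
    unfolding i_def by (rule LeastI, rule Least_le)
  have "ht p ` ?S = {..<i}"
  proof (intro set_eqI iffI)
    fix j assume "j \<in> {..<i}"
    then show "j \<in> ht p ` ?S" using not_less_Least unfolding i_def by auto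
  next
    fix j assume "j \<in> ht p ` ?S"
    then obtain \<nu> where \<nu>: "\<nu> \<in> ?S" "j = ht p \<nu>" by blast
    have sub: "splits_below p \<nu> \<subseteq> ?S"
    proof
      fix \<nu>' assume "\<nu>' \<in> splits_below p \<nu>"
      then have "\<nu>' \<in> p" "\<nu>' \<subseteq>\<^sub>m \<nu>" "len \<nu>' < len \<nu>" "splits p \<nu>'"
        using splits_below_iff[OF assms(1) S(2)[OF \<nu>(1)]] by blast+
      then show "\<nu>' \<in> ?S"
        using splits_below_iff[OF assms(1) less.prems] S[OF \<nu>(1)] map_le_trans
        by (metis order.strict_trans)
    qed
    have "{..<j} \<subseteq> ht p ` ?S"
      using IH(1)[OF \<nu>(1)] \<nu>(2) image_mono[OF sub, of "ht p"] by simp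
    then have "\<not> i < j" using i(1) by blast
    moreover have "i \<noteq> j" using i(1) \<nu> by blast
    ultimately show "j \<in> {..<i}" by auto
  qed
  moreover from this have "ht p \<eta> = i"
    using inj ord by (intro ht_eqI[where g = "ht p"]) (auto simp: bij_betw_def)
  ultimately show ?case using i(2) by simp
qed

lemmas ht_image_splits_below = ht_image_splits_below_aux[THEN conjunct1]
  and ht_le_len = ht_image_splits_below_aux[THEN conjunct2]

lemma ht_less:
  assumes "is_tree p" "\<eta> \<in> seqs" "\<nu> \<in> p" "\<nu> \<subseteq>\<^sub>m \<eta>" "len \<nu> < len \<eta>" "splits p \<nu>"
  shows "ht p \<nu> < ht p \<eta>"
  using ht_image_splits_below[OF assms(1,2)] assms by (auto simp: splits_below_iff)

text \<open>No height is skipped on the way up to \<eta>, since the heights of the splitting nodes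
  below it form a whole initial segment.\<close>

lemma ht_lessE:
  assumes "is_tree p" "\<eta> \<in> seqs" "i < ht p \<eta>"
  obtains \<nu> where "\<nu> \<in> split_level i p" "\<nu> \<subseteq>\<^sub>m \<eta>" "len \<nu> < len \<eta>"
proof -
  obtain \<nu> where "\<nu> \<in> splits_below p \<eta>" "ht p \<nu> = i"
    using ht_image_splits_below[OF assms(1,2)] assms(3) by (metis imageE lessThan_iff)
  then show ?thesis
    using that assms by (auto simp: splits_below_iff split_level_def)
qed

lemma ht_mono:
  assumes "is_tree p" "\<eta> \<in> seqs" "\<nu> \<in> seqs" "\<nu> \<subseteq>\<^sub>m \<eta>"
  shows "ht p \<nu> \<le> ht p \<eta>"
proof (rule ccontr)
  assume "\<not> ht p \<nu> \<le> ht p \<eta>"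
  then obtain \<nu>' where "\<nu>' \<in> split_level (ht p \<eta>) p" "\<nu>' \<subseteq>\<^sub>m \<nu>" "len \<nu>' < len \<nu>"
    using ht_lessE[OF assms(1,3)] by (metis not_le)
  moreover from this have "len \<nu>' < len \<eta>"
    using init_len_le[OF assms(3,2,4)] by order
  ultimately have "ht p \<nu>' < ht p \<eta>"
    using ht_less[OF assms(1,2), of \<nu>'] map_le_trans[OF _ assms(4)]
    by (simp add: split_level_def)
  then show False using \<open>\<nu>' \<in> _\<close> by (simp add: split_level_def)
qed

lemma splits_cong: "succs t \<eta> = succs t' \<eta> \<Longrightarrow> splits t \<eta> \<longleftrightarrow> splits t' \<eta>"
  by (simp add: splits_def)

lemma splits_subset: "q \<subseteq> p \<Longrightarrow> splits q \<eta> \<Longrightarrow> splits p \<eta>"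
  by (auto simp: splits_def succs_def)

text \<open>Otherwise \<open>q\<close> splits below \<eta> at a node whose height in
  \<open>q\<close> is \<open>ht p \<eta>\<close>. That node has smaller height in \<open>p\<close>,
  and by induction on the length also in \<open>q\<close>, a contradiction.\<close>

lemma ht_subset:
  assumes "is_tree p" "is_tree q" "q \<subseteq> p" "\<eta> \<in> seqs"
  shows "ht q \<eta> \<le> ht p \<eta>"
  using assms(4)
proof (induction "len \<eta>" arbitrary: \<eta> rule: less_induct)
  case less
  show ?case
  proof (rule ccontr)
    assume "\<not> ht q \<eta> \<le> ht p \<eta>"
    then obtain \<nu> where \<nu>: "\<nu> \<in> split_level (ht p \<eta>) q" "\<nu> \<subseteq>\<^sub>m \<eta>" "len \<nu> < len \<eta>"
      using ht_lessE[OF assms(2) less.prems] by (metis not_le)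
    then have "ht q \<nu> \<le> ht p \<nu>"
      using less.hyps[OF \<nu>(3)] is_tree_seqs[OF assms(2)] by (simp add: split_level_def)
    moreover have "ht p \<nu> < ht p \<eta>"
      using ht_less[OF assms(1) less.prems] \<nu> assms(3) splits_subset[OF assms(3)]
      by (auto simp: split_level_def)
    ultimately show False using \<nu> by (auto simp: split_level_def)
  qed
qed


section \<open>Ordinals below an inaccessible cardinal\<close>

lemma ozero_le [simp]: "ozero \<le> a"
  unfolding ozero_def by (rule Least_le) simp

lemma lessThan_ozero [simp]: "{..<ozero} = {}"
  by (auto simp: leD)

locale inaccessible_tree =
  fixes f :: "'k::wellorder \<Rightarrow> 'k"
  assumes inacc: "inaccessible (ord_rel :: 'k rel)"
    and mono_f: "strict_mono f"
    and f_ozero: "f ozero > osucc ozero"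
begin

lemma ord_rel_ordIso: "(ord_rel :: 'k rel) =o |UNIV :: 'k set|"
  using inacc card_of_Field_ordIso[of "ord_rel :: 'k rel"] ordIso_symmetric
  by (auto simp: inaccessible_def)

lemma ordLess_kappa: "r <o (ord_rel :: 'k rel) \<longleftrightarrow> r <o |UNIV :: 'k set|"
  using ordLess_ordIso_trans[OF _ ord_rel_ordIso]
    ordLess_ordIso_trans[OF _ ordIso_symmetric[OF ord_rel_ordIso]] by blast

lemma card_nat_less: "|UNIV :: nat set| <o |UNIV :: 'k set|"
proof -
  have "natLeq <o |UNIV :: 'k set|" using inacc by (simp add: inaccessible_def ordLess_kappa)
  then show ?thesis using card_of_nat ordIso_ordLess_trans by blast
qed

lemma infinite_kappa: "infinite (UNIV :: 'k set)"
  by (rule card_of_ordLeq_infinite[OF ordLess_imp_ordLeq[OF card_nat_less] infinite_UNIV_nat])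

lemma stable_kappa: "stable |UNIV :: 'k set|"
proof -
  have "stable (ord_rel :: 'k rel)"
    using inacc infinite_kappa by (intro regularCard_stable) (auto simp: inaccessible_def)
  then show ?thesis
    using stable_ordIso1 ord_rel_ordIso ordIso_symmetric by blast
qed

text \<open>This is where \<kappa> counts as a cardinal: proper segments of an initial ordinal have
  smaller size.\<close>

lemma card_lessThan_less: "|{..<a :: 'k}| <o |UNIV :: 'k set|"
proof -
  have "|underS (ord_rel :: 'k rel) a| <o (ord_rel :: 'k rel)"
    using inacc by (intro card_of_underS) (auto simp: inaccessible_def)
  then show ?thesis by (simp add: underS_ord_rel ordLess_kappa)
qed

lemma card_image_less: "|A| <o |UNIV :: 'k set| \<Longrightarrow> |g ` A| <o |UNIV :: 'k set|"
  by (rule ordLeq_ordLess_trans[OF card_of_image])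

lemma card_subset_less: "B \<subseteq> A \<Longrightarrow> |A| <o |UNIV :: 'k set| \<Longrightarrow> |B| <o |UNIV :: 'k set|"
  by (rule ordLeq_ordLess_trans[OF card_of_mono1])

text \<open>The strong limit property speaks of subsets of \<open>Field r\<close> only, so a small
  set of any type is first copied into \<kappa>.\<close>

lemma card_Pow_less:
  assumes "|A| <o |UNIV :: 'k set|"
  shows "|Pow A| <o |UNIV :: 'k set|"
proof -
  obtain g :: "'a \<Rightarrow> 'k" where g: "inj_on g A"
    using iffD2[OF card_of_ordLeq ordLess_imp_ordLeq[OF assms]] by blast
  have "|g ` A| <o (ord_rel :: 'k rel)"
    using card_image_less[OF assms, of g] by (simp add: ordLess_kappa)
  then have "|Pow (g ` A)| <o |UNIV :: 'k set|"
    using inacc by (auto simp: inaccessible_def ordLess_kappa)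
  moreover have "|Pow A| \<le>o |Pow (g ` A)|"
  proof -
    have "inj_on (image g) (Pow A)" using g by (simp add: inj_on_image_Pow)
    moreover have "image g ` Pow A \<subseteq> Pow (g ` A)" by auto
    ultimately show ?thesis using card_of_ordLeq[of "Pow A" "Pow (g ` A)"] by blast
  qed
  ultimately show ?thesis using ordLeq_ordLess_trans by blast
qed

text \<open>Otherwise \<kappa> would be a proper segment with one point added, hence too small. This
  gives meaning to the \<open>LEAST\<close> in \<open>osucc\<close>.\<close>

lemma ex_greater: "\<exists>b. (a :: 'k) < b"
proof (rule ccontr)
  assume "\<nexists>b. a < b"
  then have U: "UNIV = {..<a} \<union> {a}" by (auto simp: not_less order.order_iff_strict)
  have "|{a}| <o |UNIV :: 'k set|"
    using infinite_kappa
    by (intro finite_ordLess_infinite card_of_Well_order) (simp_all add: Field_card_of)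
  then have "|{..<a} \<union> {a}| <o |UNIV :: 'k set|"
    using card_of_Un_ordLess_infinite[OF infinite_kappa card_lessThan_less] by blast
  then have "|UNIV :: 'k set| <o |UNIV :: 'k set|" by (simp only: U[symmetric])
  then show False using ordLess_irreflexive by blast
qed

lemma less_osucc [simp]: "(a :: 'k) < osucc a"
  unfolding osucc_def using LeastI_ex[OF ex_greater] .

lemma osucc_le: "(a :: 'k) < b \<Longrightarrow> osucc a \<le> b"
  unfolding osucc_def by (rule Least_le)

lemma less_osucc_iff: "b < osucc a \<longleftrightarrow> (b :: 'k) \<le> a"
  using osucc_le[of a b] less_osucc[of a] by (metis leD leI le_less_trans)

lemma lessThan_osucc: "{..<osucc a} = insert a {..<a :: 'k}"
  by (auto simp: less_osucc_iff)

text \<open>Regularity: an unbounded \<open>K\<close> would cover \<kappa> by the segments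
  \<open>{..<osucc k}\<close>. The successor appears because failing to lie strictly below
  \<open>b\<close> only yields \<open>b \<le> k\<close>.\<close>

lemma bounded_if_card_less:
  assumes "|K| <o |UNIV :: 'k set|"
  shows "\<exists>b. \<forall>k\<in>K. (k :: 'k) < b"
proof (rule ccontr)
  assume *: "\<nexists>b. \<forall>k\<in>K. k < b"
  have "|\<Union>k\<in>K. {..<osucc k}| <o |UNIV :: 'k set|"
    by (rule stable_UNION[OF stable_kappa assms card_lessThan_less])
  moreover have "(\<Union>k\<in>K. {..<osucc k}) = UNIV"
    using * by (auto simp: less_osucc_iff not_less)
  ultimately show False using ordLess_irreflexive[of "|UNIV :: 'k set|"] by simp
qed

lemma ord_cases:
  obtains "(a :: 'k) = ozero" | b where "a = osucc b" | "olimit a"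
proof -
  have "\<exists>b. a = osucc b" if "a \<noteq> ozero" "\<not> olimit a"
  proof -
    from that obtain b where "b < a" "\<not> osucc b < a" by (auto simp: olimit_def)
    then have "a = osucc b" using osucc_le[of b a] by auto
    then show ?thesis ..
  qed
  then show ?thesis using that by blast
qed

lemma olimit_osucc: "olimit l \<Longrightarrow> (a :: 'k) < l \<Longrightarrow> osucc a < l"
  by (simp add: olimit_def)

lemma not_olimit_osucc: "\<not> olimit (osucc (a :: 'k))"
  using less_osucc[of a] by (metis olimit_def less_irrefl)

text \<open>Since \<kappa> is uncountable and regular, the supremum of \<omega> many ordinals stays
  below it; strict growth makes that supremum a limit.\<close>

lemma ex_limit_of_sequence:
  fixes s :: "nat \<Rightarrow> 'k"
  assumes "\<And>n. s n < s (Suc n)"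
  obtains l where "olimit l" "\<And>n. s n < l" "\<And>x. x < l \<Longrightarrow> \<exists>n. x < s n"
proof -
  have "|range s| <o |UNIV :: 'k set|" by (rule card_image_less[OF card_nat_less])
  then obtain b where "\<forall>n. s n < b" using bounded_if_card_less by blast
  define l where "l = (LEAST l. \<forall>n. s n < l)"
  have l: "\<forall>n. s n < l" unfolding l_def by (rule LeastI) fact
  have cof: "\<exists>n. x < s n" if "x < l" for x
  proof -
    have "\<not> (\<forall>n. s n < x)" using that not_less_Least unfolding l_def by blast
    then obtain n where "x \<le> s n" by (auto simp: not_less)
    then have "x < s (Suc n)" using assms[of n] by simp
    then show ?thesis ..
  qed
  have "osucc x < l" if x: "x < l" for x
  proof -
    obtain n where "x < s n" using cof[OF x] by blast
    then show ?thesis using osucc_le[of x "s n"] l by (meson le_less_trans)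
  qed
  moreover have "l \<noteq> ozero" using l ozero_le[of "s 0"] by (metis leD)
  ultimately have "olimit l" by (simp add: olimit_def)
  then show ?thesis using that l cof by blast
qed

lemma f_gt: "ozero < f a" "osucc ozero < f a"
proof -
  have "f ozero \<le> f a" using mono_f by (simp add: strict_mono_less_eq)
  then show "osucc ozero < f a" using f_ozero by simp
  then show "ozero < f a" using less_osucc[of "ozero :: 'k"] by (meson less_trans)
qed

section \<open>Successors and splitting\<close>

lemma dom_snoc: "\<eta> \<in> seqs \<Longrightarrow> dom (snoc \<eta> (\<alpha> :: 'k)) = {..<osucc (len \<eta>)}"
  by (simp add: snoc_def dom_seqs lessThan_osucc)

lemma snoc_seqs: "\<eta> \<in> seqs \<Longrightarrow> snoc \<eta> (\<alpha> :: 'k) \<in> seqs"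
  by (rule seqsI[OF dom_snoc])

lemma len_snoc [simp]: "\<eta> \<in> seqs \<Longrightarrow> len (snoc \<eta> (\<alpha> :: 'k)) = osucc (len \<eta>)"
  by (rule len_eqI[OF dom_snoc])

lemma init_snoc: "\<eta> \<in> seqs \<Longrightarrow> \<eta> \<subseteq>\<^sub>m snoc \<eta> (\<alpha> :: 'k)"
  using dom_seqs[of \<eta>] by (auto simp: snoc_def map_le_def)

lemma snoc_inject [simp]: "snoc \<eta> \<alpha> = snoc \<eta> \<beta> \<longleftrightarrow> \<alpha> = (\<beta> :: 'k)"
  using map_upd_eqD1 by (metis snoc_def)

lemma restrict_osucc:
  assumes "{..<osucc (x :: 'k)} \<subseteq> dom m"
  shows "m |` {..<osucc x} = snoc (m |` {..<x}) (the (m x))"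
proof -
  have "dom (m |` {..<x}) = {..<x}"
    using assms by (intro dom_restrict_lessThan) (auto simp: lessThan_osucc)
  then have l: "len (m |` {..<x}) = x" by (rule len_eqI)
  have "x \<in> dom m" using assms by (auto simp: lessThan_osucc)
  then show ?thesis
    unfolding snoc_def l by (auto simp: fun_eq_iff restrict_map_def lessThan_osucc)
qed

lemma restrict_osucc_len:
  assumes "\<eta> \<in> seqs" "\<nu> \<in> seqs" "\<eta> \<subseteq>\<^sub>m \<nu>" "len \<eta> < len (\<nu> :: 'k node)"
  shows "\<nu> |` {..<osucc (len \<eta>)} = snoc \<eta> (the (\<nu> (len \<eta>)))"
proof -
  have "{..<osucc (len \<eta>)} \<subseteq> dom \<nu>"
    using assms dom_seqs[of \<nu>] osucc_le[of "len \<eta>" "len \<nu>"] by simp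
  then show ?thesis using restrict_osucc init_eq_restrict[OF assms(1,3)] by metis
qed

text \<open>Stated for arbitrary maps, because it compares a branch with a node as well as two nodes
  of the same level.\<close>

lemma splits_at_difference:
  assumes "b |` {..<osucc x} \<in> p" "c |` {..<osucc x} \<in> p" "{..<osucc (x :: 'k)} \<subseteq> dom b"
    "{..<osucc x} \<subseteq> dom c" "b |` {..<x} = c |` {..<x}" "b x \<noteq> c x"
  shows "splits p (b |` {..<x})"
proof -
  have "x \<in> dom b" "x \<in> dom c" using assms by (auto simp: lessThan_osucc)
  then have "the (b x) \<noteq> the (c x)" using assms(6) by auto
  then have "snoc (b |` {..<x}) (the (b x)) \<noteq> snoc (b |` {..<x}) (the (c x))" by simp
  moreover have "snoc (b |` {..<x}) (the (b x)) \<in> p" "snoc (b |` {..<x}) (the (c x)) \<in> p"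
    using assms restrict_osucc[of x b] restrict_osucc[of x c] by auto
  ultimately show ?thesis unfolding splits_def succs_def by blast
qed

abbreviation full_succs :: "'k node \<Rightarrow> 'k node set" where
  "full_succs \<eta> \<equiv> {snoc \<eta> \<alpha> |\<alpha>. \<alpha> < f (len \<eta>)}"

text \<open>As \<open>f\<close> takes only values above 1, a full successor set has two elements,
  and the two alternatives in \<open>PT\<close> exclude each other.\<close>

lemma full_succs_two: "\<exists>\<nu>\<in>full_succs \<eta>. \<exists>\<nu>'\<in>full_succs \<eta>. \<nu> \<noteq> \<nu>'"
proof -
  have "snoc \<eta> ozero \<noteq> snoc \<eta> (osucc ozero)"
    using less_osucc[of "ozero :: 'k"] by (metis less_irrefl snoc_inject)
  then show ?thesis using f_gt[of "len \<eta>"] by blast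
qed

lemma full_imp_splits: "succs p \<eta> = full_succs \<eta> \<Longrightarrow> splits p \<eta>"
  unfolding splits_def using full_succs_two by simp

context
  fixes p assumes p: "p \<in> PT f"
begin

lemma PT_nonempty: "p \<noteq> {}" and PT_is_tree: "is_tree p"
  and PT_bound: "\<eta> \<in> p \<Longrightarrow> i \<in> dom \<eta> \<Longrightarrow> the (\<eta> i) < f i"
  and PT_succs: "\<eta> \<in> p \<Longrightarrow> (\<exists>!\<nu>. \<nu> \<in> succs p \<eta>) \<or> succs p \<eta> = full_succs \<eta>"
  and PT_ex_splits: "\<eta> \<in> p \<Longrightarrow> \<exists>\<nu>\<in>p. \<eta> \<subseteq>\<^sub>m \<nu> \<and> splits p \<nu>"
  and PT_limit_in: "olimit l \<Longrightarrow> \<eta> \<in> seqs_len l \<Longrightarrow> (\<And>i. i < l \<Longrightarrow> \<eta> |` {..<i} \<in> p) \<Longrightarrow> \<eta> \<in> p"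
  and PT_limit_splits: "olimit l \<Longrightarrow> \<eta> \<in> p \<Longrightarrow> \<eta> \<in> seqs_len l \<Longrightarrow>
    (\<And>i. i < l \<Longrightarrow> \<exists>\<nu>\<in>splits_below p \<eta>. i < len \<nu>) \<Longrightarrow> splits p \<eta>"
proof -
  note c1 = p[unfolded PT_def mem_Collect_eq]
  note c2 = c1[THEN conjunct2] note c3 = c2[THEN conjunct2] note c4 = c3[THEN conjunct2]
  note c5 = c4[THEN conjunct2] note c6 = c5[THEN conjunct2]
  show "p \<noteq> {}" "is_tree p" using c1 c2 by simp_all
  show "the (\<eta> i) < f i" if "\<eta> \<in> p" "i \<in> dom \<eta>"
    using c3[THEN conjunct1] that by blast
  show "(\<exists>!\<nu>. \<nu> \<in> succs p \<eta>) \<or> succs p \<eta> = full_succs \<eta>" if "\<eta> \<in> p"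
    using c4[THEN conjunct1] that by (rule bspec)
  show "\<exists>\<nu>\<in>p. \<eta> \<subseteq>\<^sub>m \<nu> \<and> splits p \<nu>" if "\<eta> \<in> p"
    using c5[THEN conjunct1] that by (rule bspec)
  show "\<eta> \<in> p" if "olimit l" "\<eta> \<in> seqs_len l" "\<And>i. i < l \<Longrightarrow> \<eta> |` {..<i} \<in> p"
    using c6[THEN conjunct1] that by blast
  show "splits p \<eta>" if "olimit l" "\<eta> \<in> p" "\<eta> \<in> seqs_len l"
    "\<And>i. i < l \<Longrightarrow> \<exists>\<nu>\<in>splits_below p \<eta>. i < len \<nu>"
    using c6[THEN conjunct2] that by blast
qed

lemma PT_seqs: "\<eta> \<in> p \<Longrightarrow> \<eta> \<in> seqs"
  using PT_is_tree is_tree_seqs by blast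

lemma PT_splits_iff: "\<eta> \<in> p \<Longrightarrow> splits p \<eta> \<longleftrightarrow> succs p \<eta> = full_succs \<eta>"
  using PT_succs[of \<eta>] full_imp_splits[of p \<eta>] unfolding splits_def by blast

lemma PT_succs_nonempty: "\<eta> \<in> p \<Longrightarrow> succs p \<eta> \<noteq> {}"
  using PT_succs[of \<eta>] full_succs_two[of \<eta>] by blast

lemma PT_empty_in: "Map.empty \<in> p"
proof -
  obtain \<eta> where "\<eta> \<in> p" using PT_nonempty by blast
  moreover have "Map.empty \<in> (seqs :: 'k node set)" by (rule seqsI[of _ ozero]) simp
  ultimately show ?thesis using is_tree_init[OF PT_is_tree] by simp
qed

end

text \<open>The limit clauses are phrased through \<open>len \<eta>\<close>. Only the closure
  direction of the first one is asked for, as the converse holds in every tree.\<close>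

lemma PT_I:
  fixes p :: "'k node set"
  assumes "is_tree p" "\<eta>\<^sub>0 \<in> p"
    and "\<And>\<eta> i. \<eta> \<in> p \<Longrightarrow> i \<in> dom \<eta> \<Longrightarrow> the (\<eta> i) < f i"
    and "\<And>\<eta>. \<eta> \<in> p \<Longrightarrow> (\<exists>!\<nu>. \<nu> \<in> succs p \<eta>) \<or> succs p \<eta> = full_succs \<eta>"
    and "\<And>\<eta>. \<eta> \<in> p \<Longrightarrow> \<exists>\<nu>\<in>p. \<eta> \<subseteq>\<^sub>m \<nu> \<and> splits p \<nu>"
    and "\<And>\<eta>. olimit (len \<eta>) \<Longrightarrow> \<eta> \<in> seqs \<Longrightarrow> (\<And>i. i < len \<eta> \<Longrightarrow> \<eta> |` {..<i} \<in> p) \<Longrightarrow> \<eta> \<in> p"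
    and "\<And>\<eta>. olimit (len \<eta>) \<Longrightarrow> \<eta> \<in> p \<Longrightarrow> \<eta> \<in> seqs \<Longrightarrow>
      (\<And>i. i < len \<eta> \<Longrightarrow> \<exists>\<nu>\<in>p. \<nu> \<subseteq>\<^sub>m \<eta> \<and> len \<nu> < len \<eta> \<and> splits p \<nu> \<and> i < len \<nu>) \<Longrightarrow> splits p \<eta>"
  shows "p \<in> PT f"
  unfolding PT_def mem_Collect_eq
proof (intro conjI allI impI ballI)
  show "p \<noteq> {}" "is_tree p" using assms(1,2) by auto
next
  fix l and \<eta> :: "'k node" assume l: "olimit l" "\<eta> \<in> seqs_len l"
  show "\<eta> \<in> p \<longleftrightarrow> (\<forall>i<l. \<eta> |` {..<i} \<in> p)"
    using assms(6)[of \<eta>] l is_tree_restrict[OF assms(1)] by (auto simp: seqs_len_iff)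
next
  fix l \<eta> assume l: "olimit l" "\<eta> \<in> p \<inter> seqs_len l"
    and *: "\<forall>i<l. \<exists>\<nu>\<in>splits_below p \<eta>. i < len \<nu>"
  then have \<eta>: "\<eta> \<in> p" "\<eta> \<in> seqs" "len \<eta> = l" by (auto simp: seqs_len_iff)
  show "splits p \<eta>"
  proof (rule assms(7))
    show "olimit (len \<eta>)" "\<eta> \<in> p" "\<eta> \<in> seqs" using l(1) \<eta> by auto
    fix i assume "i < len \<eta>"
    then have "i < l" using \<eta>(3) by simp
    then obtain \<nu> where "\<nu> \<in> splits_below p \<eta>" "i < len \<nu>" using * by blast
    then show "\<exists>\<nu>\<in>p. \<nu> \<subseteq>\<^sub>m \<eta> \<and> len \<nu> < len \<eta> \<and> splits p \<nu> \<and> i < len \<nu>"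
      using splits_below_iff[OF assms(1) \<eta>(2)] by blast
  qed
qed (use assms(3,4,5) in blast)+

section \<open>Branches\<close>

definition branch :: "'k node set \<Rightarrow> 'k node \<Rightarrow> bool" where
  "branch p b \<longleftrightarrow> dom b = UNIV \<and> (\<forall>a. b |` {..<a} \<in> p)"

lemma branch_restrict:
  assumes "branch p b"
  shows "b |` {..<a} \<in> p" "b |` {..<a} \<in> seqs" "len (b |` {..<a}) = a" "{..<a} \<subseteq> dom b"
proof -
  show "b |` {..<a} \<in> p" "{..<a} \<subseteq> dom b" using assms by (auto simp: branch_def)
  then have "dom (b |` {..<a}) = {..<a}" using dom_restrict_lessThan by blast
  then show "b |` {..<a} \<in> seqs" "len (b |` {..<a}) = a" by (rule seqsI, rule len_eqI)
qed

lemma branch_subset: "branch q b \<Longrightarrow> q \<subseteq> p \<Longrightarrow> branch p b"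
  by (auto simp: branch_def)

text \<open>Recursion along \<kappa> whose value at \<open>a\<close> depends on the whole history
  below \<open>a\<close>. Restriction hides the default values that \<open>cut\<close> puts outside
  the history.\<close>

lemma ex_recursive_map: "\<exists>b. \<forall>a :: 'k. b a = G a (b |` {..<a})"
proof -
  let ?F = "\<lambda>g a. G a (g |` {..<a})"
  let ?b = "wfrec {(x, y). x < y} ?F"
  have "?b a = G a (?b |` {..<a})" for a
  proof -
    have "cut ?b {(x, y). x < y} a |` {..<a} = ?b |` {..<a}"
      by (auto simp: cut_def restrict_map_def fun_eq_iff)
    then show ?thesis using wfrec[OF wf, of ?F a] by simp
  qed
  then show ?thesis by blast
qed

text \<open>The assumptions are clauses that the intersection of a chain satisfies before it is
  known to be a condition, so that a branch is available for proving that it is one.\<close>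

lemma ex_branch:
  assumes tree: "is_tree p" and succ: "\<And>\<eta>. \<eta> \<in> p \<Longrightarrow> succs p \<eta> \<noteq> {}"
    and lim: "\<And>\<eta>. olimit (len \<eta>) \<Longrightarrow> \<eta> \<in> seqs \<Longrightarrow> (\<And>i. i < len \<eta> \<Longrightarrow> \<eta> |` {..<i} \<in> p) \<Longrightarrow> \<eta> \<in> p"
    and \<eta>: "\<eta> \<in> p"
  obtains b where "branch p b" "\<eta> \<subseteq>\<^sub>m b"
proof -
  \<comment> \<open>The recursion copies \<eta> as long as it lasts and then picks any successor; at
    limits the closure of \<open>p\<close> keeps the branch inside.\<close>
  obtain b where b: "\<And>a. b a = (if a < len \<eta> then \<eta> a
      else Some (SOME \<alpha>. snoc (b |` {..<a}) \<alpha> \<in> p))"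
    using ex_recursive_map[of "\<lambda>a m. if a < len \<eta> then \<eta> a
      else Some (SOME \<alpha>. snoc m \<alpha> \<in> p)"] by blast
  have \<eta>s: "\<eta> \<in> seqs" using tree \<eta> is_tree_seqs by blast
  have "b a \<noteq> None" for a
    using b[of a] dom_seqs[OF \<eta>s] by (cases "a < len \<eta>") (auto simp: set_eq_iff domIff)
  then have dom: "dom b = UNIV" by auto
  have \<eta>b: "\<eta> \<subseteq>\<^sub>m b" using b dom_seqs[OF \<eta>s] by (auto simp: map_le_def)
  have "b |` {..<a} \<in> p" for a
  proof (induction a rule: less_induct)
    case (less a)
    have da: "dom (b |` {..<a}) = {..<a}" using dom by (intro dom_restrict_lessThan) simp
    show ?case
    proof (cases "a \<le> len \<eta>")
      case True
      then have "b |` {..<a} = \<eta> |` {..<a}" using b by (auto simp: restrict_map_def fun_eq_iff)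
      then show ?thesis using is_tree_restrict[OF tree \<eta>] by simp
    next
      case False
      show ?thesis
      proof (cases a rule: ord_cases)
        case 1
        then show ?thesis using False by simp
      next
        case (2 c)
        have "c < a" using 2 by simp
        then have c: "b |` {..<c} \<in> p" by (rule less.IH)
        then obtain \<alpha> where "snoc (b |` {..<c}) \<alpha> \<in> p"
          using succ[OF c] by (auto simp: succs_def)
        then have "snoc (b |` {..<c}) (SOME \<alpha>. snoc (b |` {..<c}) \<alpha> \<in> p) \<in> p" by (rule someI)
        moreover have "b c = Some (SOME \<alpha>. snoc (b |` {..<c}) \<alpha> \<in> p)"
          using b[of c] False 2 by (metis less_osucc_iff not_le)
        moreover have "b |` {..<a} = snoc (b |` {..<c}) (the (b c))"
          unfolding 2 using dom by (intro restrict_osucc) simp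
        ultimately show ?thesis by simp
      next
        case 3
        show ?thesis
        proof (rule lim)
          show "olimit (len (b |` {..<a}))" "b |` {..<a} \<in> seqs"
            using 3 seqsI[OF da] len_eqI[OF da] by simp_all
          fix i assume "i < len (b |` {..<a})"
          then have "i < a" using len_eqI[OF da] by simp
          then have "b |` {..<a} |` {..<i} = b |` {..<i}" by (auto simp: restrict_map_def fun_eq_iff)
          then show "b |` {..<a} |` {..<i} \<in> p" using less.IH[OF \<open>i < a\<close>] by simp
        qed
      qed
    qed
  qed
  then show ?thesis using that dom \<eta>b by (auto simp: branch_def)
qed

lemma PT_ex_branch:
  assumes "p \<in> PT f" "\<eta> \<in> p"
  obtains b where "branch p b" "\<eta> \<subseteq>\<^sub>m b"
proof (rule ex_branch[OF PT_is_tree[OF assms(1)] PT_succs_nonempty[OF assms(1)] _ assms(2)])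
  fix \<nu> :: "'k node"
  assume "olimit (len \<nu>)" "\<nu> \<in> seqs" "\<And>i. i < len \<nu> \<Longrightarrow> \<nu> |` {..<i} \<in> p"
  then show "\<nu> \<in> p" using PT_limit_in[OF assms(1), of "len \<nu>" \<nu>] by (simp add: seqs_len_iff)
qed (use that in blast)

text \<open>Before its next splitting node, a node has no choice but to follow the branch.\<close>

lemma branch_splits_above:
  assumes p: "p \<in> PT f" and b: "branch p b"
  obtains c where "a \<le> c" "splits p (b |` {..<c})"
proof (rule ccontr)
  assume "\<not> thesis"
  with that have no: "\<not> splits p (b |` {..<c})" if "a \<le> c" for c using \<open>a \<le> c\<close> by blast
  obtain \<nu> where \<nu>: "\<nu> \<in> p" "b |` {..<a} \<subseteq>\<^sub>m \<nu>" "splits p \<nu>"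
    using PT_ex_splits[OF p branch_restrict(1)[OF b]] by blast
  have \<nu>s: "\<nu> \<in> seqs" using PT_seqs[OF p \<nu>(1)] .
  have "a \<le> len \<nu>"
    using init_len_le[OF branch_restrict(2)[OF b] \<nu>s \<nu>(2)] branch_restrict(3)[OF b] by simp
  have "b x = \<nu> x" if "x < len \<nu>" for x
    using that
  proof (induction x rule: less_induct)
    case (less x)
    show ?case
    proof (rule ccontr)
      assume ne: "b x \<noteq> \<nu> x"
      have "a \<le> x"
      proof (rule ccontr)
        assume "\<not> a \<le> x"
        then have "x \<in> dom (b |` {..<a})" using b by (auto simp: branch_def)
        then have "(b |` {..<a}) x = \<nu> x" using \<nu>(2) by (simp add: map_le_def)
        then show False using ne \<open>\<not> a \<le> x\<close> by simp
      qed
      have eq: "b |` {..<x} = \<nu> |` {..<x}"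
        using less by (auto simp: restrict_map_def fun_eq_iff)
      have "{..<osucc x} \<subseteq> dom \<nu>"
        using dom_seqs[OF \<nu>s] less.prems by (simp add: osucc_le)
      then have "splits p (b |` {..<x})"
        using splits_at_difference[OF branch_restrict(1)[OF b]
            is_tree_restrict[OF PT_is_tree[OF p] \<nu>(1)] branch_restrict(4)[OF b] _ eq ne] by blast
      then show False using no[OF \<open>a \<le> x\<close>] by blast
    qed
  qed
  then have "b |` {..<len \<nu>} = \<nu> |` {..<len \<nu>}" by (auto simp: restrict_map_def fun_eq_iff)
  then have "b |` {..<len \<nu>} = \<nu>" using \<nu>s by simp
  then show False using no[OF \<open>a \<le> len \<nu>\<close>] \<nu>(3) by simp
qed

text \<open>The closed half of the club; \<open>branch_splits_above\<close> is the unbounded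
  half.\<close>

lemma branch_splits_limit:
  assumes p: "p \<in> PT f" and b: "branch p b" and l: "olimit l"
    and cof: "\<And>i. i < l \<Longrightarrow> \<exists>c. i < c \<and> c < l \<and> splits p (b |` {..<c})"
  shows "splits p (b |` {..<l})"
proof (rule PT_limit_splits[OF p l branch_restrict(1)[OF b]])
  show "b |` {..<l} \<in> seqs_len l" using branch_restrict[OF b] by (simp add: seqs_len_iff)
  fix i assume "i < l"
  then obtain c where c: "i < c" "c < l" "splits p (b |` {..<c})" using cof by blast
  have "b |` {..<c} \<in> splits_below p (b |` {..<l})"
    using splits_below_iff[OF PT_is_tree[OF p] branch_restrict(2)[OF b]] branch_restrict[OF b]
      c restrict_le_restrict[of c l b] by simp
  then show "\<exists>\<nu>\<in>splits_below p (b |` {..<l}). i < len \<nu>"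
    using c(1) branch_restrict(3)[OF b, of c] by (intro bexI) simp_all
qed

text \<open>Heights strictly increase along the splitting levels. A bound on them would leave fewer
  than \<kappa> such levels, hence a bounded set, against
  \<open>branch_splits_above\<close>.\<close>

lemma branch_ht_unbounded:
  assumes p: "p \<in> PT f" and b: "branch p b"
  obtains c where "i < ht p (b |` {..<c})"
proof (rule ccontr)
  assume "\<not> thesis"
  then have le: "ht p (b |` {..<c}) \<le> i" for c using that not_le by blast
  let ?C = "{c. splits p (b |` {..<c})}"
  let ?h = "\<lambda>c. ht p (b |` {..<c})"
  have less: "?h c < ?h d" if "c \<in> ?C" "c < d" for c d
    using ht_less[OF PT_is_tree[OF p] branch_restrict(2,1)[OF b], of c d] branch_restrict(3)[OF b]
      that restrict_le_restrict[of c d b] by simp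
  have "inj_on ?h ?C"
    by (rule linorder_inj_onI') (use less in \<open>metis less_irrefl\<close>)
  moreover have "?h ` ?C \<subseteq> {..<osucc i}" using le by (auto simp: less_osucc_iff)
  ultimately have "|?C| \<le>o |{..<osucc i}|"
    using iffD1[OF card_of_ordLeq[of ?C "{..<osucc i}"]] by blast
  then have "|?C| <o |UNIV :: 'k set|" using card_lessThan_less ordLeq_ordLess_trans by blast
  then obtain d where d: "\<forall>c\<in>?C. c < d" using bounded_if_card_less by blast
  obtain c where "d \<le> c" "splits p (b |` {..<c})" using branch_splits_above[OF p b] .
  then show False using d by force
qed

text \<open>A branch through \<eta> reaches heights beyond \<open>i\<close> and skips none, so it
  meets level \<open>i\<close>. It does so no lower than \<eta>, as a splitting node properly below
  \<eta> has height less than \<open>ht p \<eta>\<close>.\<close>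

lemma ex_split_level_above:
  assumes p: "p \<in> PT f" and \<eta>: "\<eta> \<in> p" and i: "ht p \<eta> \<le> i"
  obtains \<nu> where "\<nu> \<in> split_level i p" "\<eta> \<subseteq>\<^sub>m \<nu>"
proof -
  have \<eta>s: "\<eta> \<in> seqs" using PT_seqs[OF p \<eta>] .
  obtain b where b: "branch p b" "\<eta> \<subseteq>\<^sub>m b" using PT_ex_branch[OF p \<eta>] .
  obtain c where "i < ht p (b |` {..<c})" using branch_ht_unbounded[OF p b(1)] .
  then obtain \<nu> where \<nu>: "\<nu> \<in> split_level i p" "\<nu> \<subseteq>\<^sub>m b |` {..<c}"
    using ht_lessE[OF PT_is_tree[OF p] branch_restrict(2)[OF b(1)]] by metis
  have \<nu>p: "\<nu> \<in> p" "splits p \<nu>" "ht p \<nu> = i" using \<nu>(1) by (auto simp: split_level_def)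
  have \<nu>s: "\<nu> \<in> seqs" using PT_seqs[OF p \<nu>p(1)] .
  have \<nu>b: "\<nu> \<subseteq>\<^sub>m b" using \<nu>(2) restrict_map_le map_le_trans by blast
  have "\<not> len \<nu> < len \<eta>"
  proof
    assume *: "len \<nu> < len \<eta>"
    then have "\<nu> \<subseteq>\<^sub>m \<eta>" using init_comparable[OF \<nu>s \<eta>s \<nu>b b(2)] by simp
    then have "ht p \<nu> < ht p \<eta>"
      using ht_less[OF PT_is_tree[OF p] \<eta>s \<nu>p(1) _ * \<nu>p(2)] by blast
    then show False using i \<nu>p(3) by simp
  qed
  then have "\<eta> \<subseteq>\<^sub>m \<nu>" using init_comparable[OF \<eta>s \<nu>s b(2) \<nu>b] by simp
  then show ?thesis using that \<nu>(1) by blast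
qed

section \<open>The orderings\<close>

text \<open>Describing \<open>\<le>\<^sub>i\<close> by all nodes of height at most \<open>i\<close> makes transitivity and monotonicity in \<open>i\<close> immediate.\<close>

lemma PT_le_at_iff:
  assumes p: "p \<in> PT f" and q: "q \<in> PT f"
  shows "PT_le_at i q p \<longleftrightarrow> q \<subseteq> p \<and> {\<eta> \<in> p. ht p \<eta> \<le> i} \<subseteq> q"
proof
  assume le: "PT_le_at i q p"
  have "\<eta> \<in> q" if \<eta>: "\<eta> \<in> p" "ht p \<eta> \<le> i" for \<eta>
  proof -
    obtain \<nu> where "\<nu> \<in> split_level i p" "\<eta> \<subseteq>\<^sub>m \<nu>"
      using ex_split_level_above[OF p \<eta>] .
    then show ?thesis
      using le is_tree_init[OF PT_is_tree[OF q] _ PT_seqs[OF p \<eta>(1)]] by (auto simp: PT_le_at_def)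
  qed
  then show "q \<subseteq> p \<and> {\<eta> \<in> p. ht p \<eta> \<le> i} \<subseteq> q" using le by (auto simp: PT_le_at_def PT_le_def)
qed (auto simp: PT_le_at_def PT_le_def split_level_def)

text \<open>Heights change from \<open>p\<close> to \<open>q\<close>, but only downwards: a node of
  height at most \<open>i\<close> in \<open>p\<close> still has height at most \<open>i\<close> in
  \<open>q\<close>, where the next step protects it.\<close>

lemma PT_le_at_trans:
  assumes "p \<in> PT f" "q \<in> PT f" "r \<in> PT f" "PT_le_at i r q" "PT_le_at i q p"
  shows "PT_le_at i r p"
proof -
  note rq = assms(4)[unfolded PT_le_at_iff[OF assms(2,3)]]
    and qp = assms(5)[unfolded PT_le_at_iff[OF assms(1,2)]]
  have "\<eta> \<in> r" if "\<eta> \<in> p" "ht p \<eta> \<le> i" for \<eta>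
  proof -
    have "\<eta> \<in> q" using qp that by blast
    moreover have "ht q \<eta> \<le> ht p \<eta>"
      using ht_subset[OF PT_is_tree[OF assms(1)] PT_is_tree[OF assms(2)] _ PT_seqs[OF assms(1)]]
        qp that(1) by blast
    ultimately show ?thesis using rq that(2) by (auto dest: order_trans)
  qed
  then show ?thesis unfolding PT_le_at_iff[OF assms(1,3)] using rq qp by blast
qed

lemma PT_le_at_mono:
  assumes "p \<in> PT f" "q \<in> PT f" "PT_le_at i q p" "j \<le> i"
  shows "PT_le_at j q p"
  using assms(3,4) unfolding PT_le_at_iff[OF assms(1,2)] by force

section \<open>Intersections of chains\<close>

lemma succs_Inter: "F \<noteq> {} \<Longrightarrow> succs (\<Inter>F) \<eta> = (\<Inter>p\<in>F. succs p \<eta>)"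
  by (auto simp: succs_def)

context
  fixes F assumes F: "F \<noteq> {}" "F \<subseteq> PT f" and chain: "\<forall>p\<in>F. \<forall>q\<in>F. p \<subseteq> q \<or> q \<subseteq> p"
begin

lemma Inter_is_tree: "is_tree (\<Inter>F)"
proof -
  have *: "is_tree p" if "p \<in> F" for p using that F PT_is_tree by blast
  then show ?thesis using F(1) unfolding is_tree_def by blast
qed

text \<open>If some member has a single successor there, larger members contain it and smaller ones
  can have no other, yet must have one. If no member does, all successor sets are full and
  equal.\<close>

lemma Inter_succs:
  assumes \<eta>: "\<eta> \<in> \<Inter>F"
  shows "(\<exists>!\<nu>. \<nu> \<in> succs (\<Inter>F) \<eta>) \<or> succs (\<Inter>F) \<eta> = full_succs \<eta>"
proof (cases "\<forall>p\<in>F. splits p \<eta>")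
  case True
  then have "succs p \<eta> = full_succs \<eta>" if "p \<in> F" for p
    using that F(2) \<eta> PT_splits_iff[of p \<eta>] by blast
  then show ?thesis using F(1) by (simp add: succs_Inter)
next
  case False
  then obtain p where p: "p \<in> F" "\<not> splits p \<eta>" by blast
  then obtain \<nu> where \<nu>: "succs p \<eta> = {\<nu>}"
    using PT_succs[of p \<eta>] PT_splits_iff[of p \<eta>] F(2) \<eta> by blast
  have "\<nu> \<in> succs q \<eta>" if q: "q \<in> F" for q
  proof (cases "p \<subseteq> q")
    case True
    then show ?thesis using \<nu> by (auto simp: succs_def)
  next
    case False
    then have "q \<subseteq> p" using chain p(1) q by blast
    then have "succs q \<eta> \<subseteq> {\<nu>}" using \<nu> by (auto simp: succs_def)
    moreover have "succs q \<eta> \<noteq> {}" using PT_succs_nonempty[of q \<eta>] F(2) q \<eta> by blast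
    ultimately show ?thesis by blast
  qed
  then have "succs (\<Inter>F) \<eta> = {\<nu>}" using \<nu> p(1) by (auto simp: succs_Inter[OF F(1)])
  then show ?thesis by auto
qed

lemma Inter_limit_in:
  assumes "olimit (len \<eta>)" "\<eta> \<in> seqs" "\<And>i. i < len \<eta> \<Longrightarrow> \<eta> |` {..<i} \<in> \<Inter>F"
  shows "\<eta> \<in> \<Inter>F"
proof
  fix p assume "p \<in> F"
  then have "p \<in> PT f" using F(2) by blast
  then show "\<eta> \<in> p"
    using PT_limit_in[of p "len \<eta>" \<eta>] assms \<open>p \<in> F\<close> by (simp add: seqs_len_iff)
qed

text \<open>Members that split at \<eta> share one and the same successor set
  \<open>full_succs \<eta>\<close>, so intersecting loses nothing.\<close>

lemma Inter_splits:
  assumes "\<eta> \<in> \<Inter>F" "\<And>p. p \<in> F \<Longrightarrow> splits p \<eta>"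
  shows "splits (\<Inter>F) \<eta>"
proof -
  have "succs p \<eta> = full_succs \<eta>" if "p \<in> F" for p
    using that F(2) assms PT_splits_iff[of p \<eta>] by blast
  then show ?thesis using F(1) by (intro full_imp_splits) (simp add: succs_Inter)
qed

text \<open>Density of splitting nodes stays a hypothesis because short sequences and fusion
  sequences of length \<kappa> supply it by different arguments.\<close>

lemma Inter_in_PT:
  assumes ex: "\<And>\<eta>. \<eta> \<in> \<Inter>F \<Longrightarrow> \<exists>\<nu>\<in>\<Inter>F. \<eta> \<subseteq>\<^sub>m \<nu> \<and> splits (\<Inter>F) \<nu>"
  shows "\<Inter>F \<in> PT f"
proof (rule PT_I[OF Inter_is_tree])
  show "Map.empty \<in> \<Inter>F" using PT_empty_in F(2) by blast
  show "the (\<eta> i) < f i" if "\<eta> \<in> \<Inter>F" "i \<in> dom \<eta>" for \<eta> i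
    using that F PT_bound by blast
  fix \<eta> assume l: "olimit (len \<eta>)" and \<eta>: "\<eta> \<in> \<Inter>F" "\<eta> \<in> seqs"
    and cof: "\<And>i. i < len \<eta> \<Longrightarrow> \<exists>\<nu>\<in>\<Inter>F. \<nu> \<subseteq>\<^sub>m \<eta> \<and> len \<nu> < len \<eta> \<and> splits (\<Inter>F) \<nu> \<and> i < len \<nu>"
  show "splits (\<Inter>F) \<eta>"
  proof (rule Inter_splits[OF \<eta>(1)])
    fix p assume pF: "p \<in> F"
    then have p: "p \<in> PT f" using F(2) by blast
    show "splits p \<eta>"
    proof (rule PT_limit_splits[OF p l])
      show "\<eta> \<in> p" "\<eta> \<in> seqs_len (len \<eta>)" using \<eta> pF by (auto simp: seqs_len_iff)
      fix i assume "i < len \<eta>"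
      then obtain \<nu> where \<nu>: "\<nu> \<in> \<Inter>F" "\<nu> \<subseteq>\<^sub>m \<eta>" "len \<nu> < len \<eta>" "splits (\<Inter>F) \<nu>" "i < len \<nu>"
        using cof by blast
      have "splits p \<nu>" using splits_subset[OF Inter_lower[OF pF] \<nu>(4)] .
      then show "\<exists>\<nu>\<in>splits_below p \<eta>. i < len \<nu>"
        using splits_below_iff[OF PT_is_tree[OF p] \<eta>(2)] \<nu> pF by blast
    qed
  qed
qed (use Inter_succs ex Inter_limit_in in blast)+

text \<open>Along a branch of the intersection the splitting levels of each tree form a club; a common
  element above any level is found as the limit of \<open>\<omega>\<close> many steps.\<close>

lemma Inter_small_in_PT:
  assumes small: "|F| <o |UNIV :: 'k set|"
  shows "\<Inter>F \<in> PT f"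
proof (rule Inter_in_PT)
  fix \<eta> assume \<eta>: "\<eta> \<in> \<Inter>F"
  have \<eta>s: "\<eta> \<in> seqs" using is_tree_seqs[OF Inter_is_tree \<eta>] .
  have ne: "succs (\<Inter>F) \<nu> \<noteq> {}" if "\<nu> \<in> \<Inter>F" for \<nu>
    using Inter_succs[OF that] full_succs_two[of \<nu>] by blast
  obtain b where b: "branch (\<Inter>F) b" "\<eta> \<subseteq>\<^sub>m b"
    using ex_branch[OF Inter_is_tree ne Inter_limit_in \<eta>] .
  have bp: "branch p b" "p \<in> PT f" if "p \<in> F" for p
    using branch_subset[OF b(1) Inter_lower[OF that]] F(2) that by auto
  \<comment> \<open>One splitting level above \<open>d\<close> is chosen in every member of
    \<open>F\<close>; regularity bounds all of them by a single \<open>e\<close>.\<close>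
  have "\<exists>e. d < e \<and> (\<forall>p\<in>F. \<exists>c. d < c \<and> c < e \<and> splits p (b |` {..<c}))" for d
  proof -
    have "\<exists>c. d < c \<and> splits p (b |` {..<c})" if pF: "p \<in> F" for p
    proof -
      obtain c where "osucc d \<le> c" "splits p (b |` {..<c})"
        using branch_splits_above[OF bp(2)[OF pF] bp(1)[OF pF]] .
      then show ?thesis using less_le_trans[OF less_osucc] by blast
    qed
    then obtain c where c: "\<And>p. p \<in> F \<Longrightarrow> d < c p \<and> splits p (b |` {..<c p})" by metis
    obtain e where e: "\<forall>k\<in>c ` F. k < e"
      using bounded_if_card_less[OF card_image_less[OF small]] by blast
    obtain p where "p \<in> F" using F(1) by blast
    then have "d < c p" "c p < e" using c e by auto
    then have "d < e" by order
    then show ?thesis using c e by blast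
  qed
  then obtain E where E: "\<And>d. d < E d"
    "\<And>d p. p \<in> F \<Longrightarrow> \<exists>c. d < c \<and> c < E d \<and> splits p (b |` {..<c})" by metis
  \<comment> \<open>Each member has a splitting level between any two consecutive terms, so the
    limit of the sequence is a limit of splitting levels of all members at once. Starting at
    \<open>len \<eta>\<close> puts it above \<eta>.\<close>
  define s where "s n = (E ^^ n) (len \<eta>)" for n
  have s: "s 0 = len \<eta>" "s (Suc n) = E (s n)" for n by (auto simp: s_def)
  obtain l where l: "olimit l" "\<And>n. s n < l" "\<And>x. x < l \<Longrightarrow> \<exists>n. x < s n"
    using ex_limit_of_sequence[of s] E(1) s(2) by metis
  have "splits p (b |` {..<l})" if "p \<in> F" for p
  proof (rule branch_splits_limit[OF bp(2)[OF that] bp(1)[OF that] l(1)])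
    fix i assume "i < l"
    then obtain n where "i < s n" using l(3) by blast
    moreover obtain c where "s n < c" "c < s (Suc n)" "splits p (b |` {..<c})"
      using E(2)[OF \<open>p \<in> F\<close>] s(2) by metis
    ultimately show "\<exists>c>i. c < l \<and> splits p (b |` {..<c})"
      using l(2)[of "Suc n"] by (meson less_trans)
  qed
  then have "splits (\<Inter>F) (b |` {..<l})" by (rule Inter_splits[OF branch_restrict(1)[OF b(1)]])
  moreover have "\<eta> \<subseteq>\<^sub>m b |` {..<l}"
    using init_comparable[OF \<eta>s branch_restrict(2)[OF b(1)] b(2) restrict_map_le]
      branch_restrict(3)[OF b(1)] l(2)[of 0] s(1) by simp
  ultimately show "\<exists>\<nu>\<in>\<Inter>F. \<eta> \<subseteq>\<^sub>m \<nu> \<and> splits (\<Inter>F) \<nu>"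
    using branch_restrict(1)[OF b(1)] by blast
qed

end

section \<open>Closure and fusion\<close>

text \<open>The largest condition. It witnesses that \<open>PT f\<close> is nonempty and is a lower
  bound of the empty sequence, whose intersection would be the set of all maps.\<close>

lemma full_tree_in_PT: "{\<eta> \<in> seqs. \<forall>i\<in>dom \<eta>. the (\<eta> i) < f i} \<in> PT f" (is "?T \<in> _")
proof -
  have tree: "is_tree ?T"
    unfolding is_tree_def
  proof (intro conjI ballI impI)
    fix \<eta> \<nu> assume *: "\<eta> \<in> ?T" "\<nu> \<in> seqs" "\<nu> \<subseteq>\<^sub>m \<eta>"
    have "the (\<nu> i) < f i" if "i \<in> dom \<nu>" for i
    proof -
      have "\<nu> i = \<eta> i" using *(3) that by (simp add: map_le_def)
      moreover have "i \<in> dom \<eta>" using *(3) that map_le_implies_dom_le by blast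
      ultimately show ?thesis using *(1) by simp
    qed
    then show "\<nu> \<in> ?T" using *(2) by blast
  qed blast
  have succs: "succs ?T \<eta> = full_succs \<eta>" if \<eta>: "\<eta> \<in> ?T" for \<eta>
  proof -
    have \<eta>s: "\<eta> \<in> seqs" using \<eta> by blast
    have "snoc \<eta> \<alpha> \<in> ?T \<longleftrightarrow> \<alpha> < f (len \<eta>)" for \<alpha>
    proof -
      have "dom (snoc \<eta> \<alpha>) = insert (len \<eta>) (dom \<eta>)" "len \<eta> \<notin> dom \<eta>"
        using dom_seqs[OF \<eta>s] dom_snoc[OF \<eta>s] by (auto simp: lessThan_osucc)
      moreover have "snoc \<eta> \<alpha> (len \<eta>) = Some \<alpha>" by (simp add: snoc_def)
      moreover have "snoc \<eta> \<alpha> i = \<eta> i" if "i \<in> dom \<eta>" for i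
        using that \<open>len \<eta> \<notin> dom \<eta>\<close> by (auto simp: snoc_def)
      ultimately show ?thesis using \<eta> snoc_seqs[OF \<eta>s] by auto
    qed
    then show ?thesis by (auto simp: succs_def)
  qed
  have splits: "splits ?T \<eta>" if "\<eta> \<in> ?T" for \<eta>
    using full_imp_splits[OF succs[OF that]] .
  show ?thesis
  proof (rule PT_I[OF tree])
    show "Map.empty \<in> ?T" using seqsI[of Map.empty ozero] by simp
    show "(\<exists>!\<nu>. \<nu> \<in> succs ?T \<eta>) \<or> succs ?T \<eta> = full_succs \<eta>" if "\<eta> \<in> ?T" for \<eta>
      using succs[OF that] ..
    show "\<exists>\<nu>\<in>?T. \<eta> \<subseteq>\<^sub>m \<nu> \<and> splits ?T \<nu>" if "\<eta> \<in> ?T" for \<eta>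
      using splits[OF that] that map_le_refl by blast
    fix \<eta> :: "'k node"
    assume l: "olimit (len \<eta>)" "\<eta> \<in> seqs" "\<And>i. i < len \<eta> \<Longrightarrow> \<eta> |` {..<i} \<in> ?T"
    have "the (\<eta> i) < f i" if "i \<in> dom \<eta>" for i
    proof -
      have "i < len \<eta>" using that dom_seqs[OF l(2)] by simp
      then have "\<eta> |` {..<osucc i} \<in> ?T" using l(3) olimit_osucc[OF l(1)] by blast
      moreover have "i \<in> dom (\<eta> |` {..<osucc i})" using that by simp
      ultimately have "the ((\<eta> |` {..<osucc i}) i) < f i" by blast
      then show ?thesis by simp
    qed
    then show "\<eta> \<in> ?T" using l(2) by blast
  qed (use splits in blast)+
qed

lemma lt_closed_PT: "lt_closed TYPE('k) (PT f) PT_le"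
  unfolding lt_closed_def
proof (intro allI impI)
  fix \<mu> :: 'k and p
  assume *: "(\<forall>j<\<mu>. p j \<in> PT f) \<and> (\<forall>i j. i < j \<and> j < \<mu> \<longrightarrow> PT_le (p j) (p i))"
  show "\<exists>q\<in>PT f. \<forall>j<\<mu>. PT_le q (p j)"
  proof (cases "p ` {..<\<mu>} = {}")
    case True
    then show ?thesis using full_tree_in_PT by blast
  next
    case False
    have "\<Inter>(p ` {..<\<mu>}) \<in> PT f"
    proof (rule Inter_small_in_PT[OF False])
      show "p ` {..<\<mu>} \<subseteq> PT f" using * by auto
      show "|p ` {..<\<mu>}| <o |UNIV :: 'k set|" by (rule card_image_less[OF card_lessThan_less])
      have "p i \<subseteq> p j \<or> p j \<subseteq> p i" if "i < \<mu>" "j < \<mu>" for i j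
        using * that by (cases i j rule: linorder_cases) (auto simp: PT_le_def)
      then show "\<forall>P\<in>p ` {..<\<mu>}. \<forall>Q\<in>p ` {..<\<mu>}. P \<subseteq> Q \<or> Q \<subseteq> P" by auto
    qed
    then show ?thesis by (rule bexI[rotated]) (auto simp: PT_le_def)
  qed
qed

text \<open>A fusion sequence directly relates only neighbours, and limits to what precedes them.
  From \<open>osucc m\<close> to \<open>m\<close> the relation with index \<open>m\<close> is given,
  and as \<open>j \<le> m\<close> it weakens to index \<open>j\<close> and composes with the
  induction hypothesis.\<close>

lemma fusion_seq_le:
  assumes I: "le_kappa_index I" and fus: "fusion_seq (PT f) PT_le_at I p"
    and "k \<in> I" "j < k"
  shows "PT_le_at j (p k) (p j)"
  using assms(3,4)
proof (induction k arbitrary: j rule: less_induct)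
  case (less k)
  have down: "m \<in> I" if "m < k" for m
    using I less.prems(1) that by (auto simp: le_kappa_index_def)
  show ?case
  proof (cases k rule: ord_cases)
    case 1
    then show ?thesis using less.prems(2) by (simp add: leD)
  next
    case (2 m)
    have m: "m \<in> I" "m < k" using 2 down by auto
    have PT: "p k \<in> PT f" "p m \<in> PT f" "p j \<in> PT f"
      using fus less.prems down[OF less.prems(2)] m by (auto simp: fusion_seq_def)
    have "j \<le> m" using less.prems(2) 2 by (simp add: less_osucc_iff)
    have "PT_le_at m (p k) (p m)"
      using fus less.prems(1) 2 by (simp add: fusion_seq_def)
    then have km: "PT_le_at j (p k) (p m)"
      using PT_le_at_mono[OF PT(2,1) _ \<open>j \<le> m\<close>] by blast
    show ?thesis
    proof (cases "j = m")
      case True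
      then show ?thesis using km by simp
    next
      case False
      then have "PT_le_at j (p m) (p j)" using less.IH[OF m(2,1)] \<open>j \<le> m\<close> by simp
      then show ?thesis using PT_le_at_trans[OF PT(3,2,1) km] by blast
    qed
  next
    case 3
    then show ?thesis using fus less.prems by (simp add: fusion_seq_def)
  qed
qed

lemma fusion_PT:
  assumes I: "le_kappa_index I" and fus: "fusion_seq (PT f) PT_le_at I p"
  shows "\<exists>q\<in>PT f. \<forall>j\<in>I. PT_le_at j q (p j)"
proof (cases "I = {}")
  case True
  then show ?thesis using full_tree_in_PT by blast
next
  case False
  let ?q = "\<Inter>(p ` I)"
  have PT: "p j \<in> PT f" if "j \<in> I" for j using fus that by (simp add: fusion_seq_def)
  have le: "PT_le_at j (p k) (p j)" if "j \<in> I" "k \<in> I" "j < k" for j k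
    using fusion_seq_le[OF I fus that(2,3)] .
  have dec: "p k \<subseteq> p j" if "j \<in> I" "k \<in> I" "j \<le> k" for j k
    using le[OF that(1,2)] that(3) by (cases "j = k") (auto simp: PT_le_at_def PT_le_def)
  \<comment> \<open>Earlier members contain \<open>p j\<close>, and later ones keep its nodes of
    height at most \<open>j\<close> because they lie below it with index \<open>j\<close>.\<close>
  have low: "\<eta> \<in> ?q" if j: "j \<in> I" "\<eta> \<in> p j" "ht (p j) \<eta> \<le> j" for j \<eta>
  proof (rule InterI)
    fix P assume "P \<in> p ` I"
    then obtain k where k: "k \<in> I" "P = p k" by blast
    show "\<eta> \<in> P"
    proof (cases "j < k")
      case True
      then show ?thesis
        using le[OF j(1) k(1)] j(2,3) k unfolding PT_le_at_iff[OF PT[OF j(1)] PT[OF k(1)]] by blast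
    next
      case False
      then have "k \<le> j" by simp
      then show ?thesis using dec[OF k(1) j(1)] j(2) k(2) by blast
    qed
  qed
  have F: "p ` I \<noteq> {}" "p ` I \<subseteq> PT f" using False PT by auto
  have "p i \<subseteq> p j \<or> p j \<subseteq> p i" if "i \<in> I" "j \<in> I" for i j
    using dec[OF that] dec[OF that(2,1)] linear by blast
  then have chain: "\<forall>P\<in>p ` I. \<forall>Q\<in>p ` I. P \<subseteq> Q \<or> Q \<subseteq> P" by blast
  have q: "?q \<in> PT f"
  proof (cases "I = UNIV")
    case True
    show ?thesis
    proof (rule Inter_in_PT[OF F chain])
      fix \<eta> assume \<eta>: "\<eta> \<in> ?q"
      \<comment> \<open>A splitting node of height \<open>i\<close> in \<open>p (osucc i)\<close> has all its successors at height at most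
        \<open>osucc i\<close>, so all of them survive in the intersection.\<close>
      define i where "i = len \<eta>"
      have pi: "p (osucc i) \<in> PT f" using PT True by blast
      note tree = PT_is_tree[OF pi]
      have \<eta>i: "\<eta> \<in> p (osucc i)" using \<eta> True by blast
      \<comment> \<open>The index \<open>i\<close> had to be fixed before the height of \<eta> in
        \<open>p (osucc i)\<close> could be considered. The length bounds the height in every tree
        at once.\<close>
      have "ht (p (osucc i)) \<eta> \<le> i"
        unfolding i_def using ht_le_len[OF tree PT_seqs[OF pi \<eta>i]] by (simp add: i_def)
      then obtain \<nu> where \<nu>: "\<nu> \<in> split_level i (p (osucc i))" "\<eta> \<subseteq>\<^sub>m \<nu>"
        using ex_split_level_above[OF pi \<eta>i] by blast
      have \<nu>': "\<nu> \<in> p (osucc i)" "splits (p (osucc i)) \<nu>" "ht (p (osucc i)) \<nu> = i"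
        using \<nu>(1) by (auto simp: split_level_def)
      have \<nu>s: "\<nu> \<in> seqs" using PT_seqs[OF pi \<nu>'(1)] .
      have "\<nu> \<in> ?q" 
        using low[OF _ \<nu>'(1)] \<nu>'(3) True less_imp_le[OF less_osucc[of i]] by simp
      have "succs (p (osucc i)) \<nu> \<subseteq> ?q"
      proof
        fix \<sigma> assume "\<sigma> \<in> succs (p (osucc i)) \<nu>"
        then obtain \<alpha> where \<sigma>: "\<sigma> \<in> p (osucc i)" "\<sigma> = snoc \<nu> \<alpha>" by (auto simp: succs_def)
        have "ht (p (osucc i)) \<sigma> \<le> osucc i"
        proof (rule ccontr)
          assume "\<not> ?thesis"
          then obtain \<tau> where \<tau>: "\<tau> \<in> split_level (osucc i) (p (osucc i))" "\<tau> \<subseteq>\<^sub>m \<sigma>" "len \<tau> < len \<sigma>"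
            using ht_lessE[OF tree PT_seqs[OF pi \<sigma>(1)]] by (metis not_le)
          then have \<tau>': "\<tau> \<in> p (osucc i)" "ht (p (osucc i)) \<tau> = osucc i"
            by (auto simp: split_level_def)
          have \<tau>s: "\<tau> \<in> seqs" using PT_seqs[OF pi \<tau>'(1)] .
          have "len \<tau> \<le> len \<nu>" using \<tau>(3) \<sigma>(2) \<nu>s by (simp add: less_osucc_iff)
          then have "\<tau> \<subseteq>\<^sub>m \<nu>"
            using init_comparable[OF \<tau>s \<nu>s \<tau>(2)] init_snoc[OF \<nu>s] \<sigma>(2) by blast
          then have "osucc i \<le> i" using ht_mono[OF tree \<nu>s \<tau>s] \<tau>'(2) \<nu>'(3) by simp
          then show False using less_osucc[of i] by (meson leD)
        qed
        then show "\<sigma> \<in> ?q" using low[OF _ \<sigma>(1)] True by blast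
      qed
      then have "splits ?q \<nu>" using \<nu>'(2) unfolding splits_def succs_def by blast
      then show "\<exists>\<nu>\<in>?q. \<eta> \<subseteq>\<^sub>m \<nu> \<and> splits ?q \<nu>" using \<open>\<nu> \<in> ?q\<close> \<nu>(2) by blast
    qed
  next
    case False
    then obtain \<mu> where "I = {..<\<mu>}" using I by (auto simp: le_kappa_index_def)
    then have "|p ` I| <o |UNIV :: 'k set|"
      using card_image_less[OF card_lessThan_less[of \<mu>], of p] by simp
    then show ?thesis by (rule Inter_small_in_PT[OF F chain])
  qed
  have "PT_le_at j ?q (p j)" if "j \<in> I" for j
    unfolding PT_le_at_iff[OF PT[OF that] q] using low[OF that] that by blast
  then show ?thesis using q by blast
qed

section \<open>Cones and amalgamation\<close>

text \<open>Initial segments of \<sigma> are kept so that the part of \<open>p\<close> above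
  \<sigma> becomes a tree again.\<close>

definition cone :: "'k node set \<Rightarrow> 'k node \<Rightarrow> 'k node set" where
  "cone p \<sigma> = {\<nu> \<in> p. \<nu> \<subseteq>\<^sub>m \<sigma> \<or> \<sigma> \<subseteq>\<^sub>m \<nu>}"

text \<open>Above \<sigma> the cone agrees with \<open>p\<close>, and strictly below it has the
  single successor towards \<sigma>. Hence it splits only above \<sigma>, which reduces the limit
  clause for splitting to that of \<open>p\<close>.\<close>

lemma cone_in_PT:
  assumes p: "p \<in> PT f" and \<sigma>: "\<sigma> \<in> p"
  shows "cone p \<sigma> \<in> PT f"
proof -
  let ?c = "cone p \<sigma>"
  note tree_p = PT_is_tree[OF p]
  have \<sigma>s: "\<sigma> \<in> seqs" using PT_seqs[OF p \<sigma>] .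
  have sub: "?c \<subseteq> p" by (auto simp: cone_def)
  have tree: "is_tree ?c"
    unfolding is_tree_def
  proof (intro conjI ballI impI)
    show "?c \<subseteq> seqs" using sub PT_seqs[OF p] by blast
    fix \<eta> \<nu> assume *: "\<eta> \<in> ?c" "\<nu> \<in> seqs" "\<nu> \<subseteq>\<^sub>m \<eta>"
    have "\<nu> \<in> p" using is_tree_init[OF tree_p] * sub by blast
    moreover have "\<nu> \<subseteq>\<^sub>m \<sigma> \<or> \<sigma> \<subseteq>\<^sub>m \<nu>"
    proof (cases "\<eta> \<subseteq>\<^sub>m \<sigma>")
      case True
      then show ?thesis using *(3) map_le_trans by blast
    next
      case False
      then have "\<sigma> \<subseteq>\<^sub>m \<eta>" using *(1) by (auto simp: cone_def)
      then show ?thesis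
        using init_comparable[OF *(2) \<sigma>s *(3)] init_comparable[OF \<sigma>s *(2) _ *(3)] linear by blast
    qed
    ultimately show "\<nu> \<in> ?c" by (simp add: cone_def)
  qed
  have above: "succs ?c \<eta> = succs p \<eta>" if \<eta>: "\<eta> \<in> p" "\<sigma> \<subseteq>\<^sub>m \<eta>" for \<eta>
  proof -
    have "\<sigma> \<subseteq>\<^sub>m snoc \<eta> \<alpha>" for \<alpha>
      using init_snoc[OF PT_seqs[OF p \<eta>(1)]] map_le_trans[OF \<eta>(2)] by blast
    then show ?thesis by (auto simp: succs_def cone_def)
  qed
  have below: "succs ?c \<eta> = {\<sigma> |` {..<osucc (len \<eta>)}}" if \<eta>: "\<eta> \<in> ?c" "\<not> \<sigma> \<subseteq>\<^sub>m \<eta>" for \<eta>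
  proof -
    have \<eta>s: "\<eta> \<in> seqs" using is_tree_seqs[OF tree \<eta>(1)] .
    have \<eta>\<sigma>: "\<eta> \<subseteq>\<^sub>m \<sigma>" using \<eta> by (auto simp: cone_def)
    then have len: "len \<eta> < len \<sigma>"
      using init_comparable[OF \<sigma>s \<eta>s map_le_refl] \<eta>(2) by (meson not_le)
    let ?\<nu> = "\<sigma> |` {..<osucc (len \<eta>)}"
    have \<nu>: "?\<nu> \<in> seqs" "len ?\<nu> = osucc (len \<eta>)"
      using seqs_restrict[OF \<sigma>s osucc_le[OF len]] by auto
    have eq: "?\<nu> = snoc \<eta> (the (\<sigma> (len \<eta>)))" using restrict_osucc_len[OF \<eta>s \<sigma>s \<eta>\<sigma> len] .
    have "?\<nu> \<in> ?c"
      using is_tree_restrict[OF tree_p \<sigma>] restrict_map_le by (auto simp: cone_def)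
    then have "?\<nu> \<in> succs ?c \<eta>" unfolding succs_def using eq by blast
    moreover have "snoc \<eta> \<alpha> = ?\<nu>" if *: "snoc \<eta> \<alpha> \<in> ?c" for \<alpha>
    proof -
      have s: "snoc \<eta> \<alpha> \<in> seqs" "len (snoc \<eta> \<alpha>) = osucc (len \<eta>)"
        using snoc_seqs[OF \<eta>s] len_snoc[OF \<eta>s] by auto
      have "snoc \<eta> \<alpha> \<subseteq>\<^sub>m \<sigma>"
      proof (cases "\<sigma> \<subseteq>\<^sub>m snoc \<eta> \<alpha>")
        case True
        then show ?thesis
          using init_comparable[OF s(1) \<sigma>s map_le_refl] s(2) osucc_le[OF len] by simp
      next
        case False
        then show ?thesis using * by (auto simp: cone_def)
      qed
      then show ?thesis using init_len_eq[OF s(1) \<nu>(1) _ restrict_map_le] s(2) \<nu>(2) by simp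
    qed
    then have "succs ?c \<eta> \<subseteq> {?\<nu>}" unfolding succs_def by blast
    ultimately show ?thesis by blast
  qed
  have not_below: "\<sigma> \<subseteq>\<^sub>m \<eta>" if "\<eta> \<in> ?c" "splits ?c \<eta>" for \<eta>
    using below[OF that(1)] that(2) by (auto simp: splits_def)
  have splits: "splits ?c \<eta> \<longleftrightarrow> splits p \<eta>" if "\<eta> \<in> p" "\<sigma> \<subseteq>\<^sub>m \<eta>" for \<eta>
    using above[OF that] by (simp add: splits_def)
  have above_ex: "\<exists>\<nu>\<in>?c. \<eta> \<subseteq>\<^sub>m \<nu> \<and> splits ?c \<nu>" if \<eta>: "\<eta> \<in> p" "\<sigma> \<subseteq>\<^sub>m \<eta>" for \<eta>
  proof -
    obtain \<nu> where \<nu>: "\<nu> \<in> p" "\<eta> \<subseteq>\<^sub>m \<nu>" "splits p \<nu>" using PT_ex_splits[OF p \<eta>(1)] by blast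
    have "\<sigma> \<subseteq>\<^sub>m \<nu>" using map_le_trans[OF \<eta>(2) \<nu>(2)] .
    then show ?thesis using \<nu> splits[OF \<nu>(1)] by (auto simp: cone_def)
  qed
  show ?thesis
  proof (rule PT_I[OF tree])
    show "\<sigma> \<in> ?c" using \<sigma> by (simp add: cone_def)
    show "the (\<eta> i) < f i" if "\<eta> \<in> ?c" "i \<in> dom \<eta>" for \<eta> i
      using that sub PT_bound[OF p] by blast
    show "(\<exists>!\<nu>. \<nu> \<in> succs ?c \<eta>) \<or> succs ?c \<eta> = full_succs \<eta>" if "\<eta> \<in> ?c" for \<eta>
    proof (cases "\<sigma> \<subseteq>\<^sub>m \<eta>")
      case True
      have "\<eta> \<in> p" using that sub by blast
      then show ?thesis using PT_succs[OF p] above[OF _ True] by simp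
    next
      case False
      then show ?thesis using below[OF that] by simp
    qed
    show "\<exists>\<nu>\<in>?c. \<eta> \<subseteq>\<^sub>m \<nu> \<and> splits ?c \<nu>" if "\<eta> \<in> ?c" for \<eta>
    proof (cases "\<sigma> \<subseteq>\<^sub>m \<eta>")
      case True
      then show ?thesis using above_ex that sub by blast
    next
      case False
      then have "\<eta> \<subseteq>\<^sub>m \<sigma>" using that by (auto simp: cone_def)
      then show ?thesis using above_ex[OF \<sigma> map_le_refl] map_le_trans by blast
    qed
  next
    fix \<eta> :: "'k node"
    assume l: "olimit (len \<eta>)" "\<eta> \<in> seqs" "\<And>i. i < len \<eta> \<Longrightarrow> \<eta> |` {..<i} \<in> ?c"
    have "\<eta> \<in> p"
      using PT_limit_in[OF p l(1)] l(2,3) sub by (auto simp: seqs_len_iff)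
    \<comment> \<open>Either some proper initial segment of \<eta> already extends \<sigma>, or all
      of them lie inside \<sigma> and so does their union \<eta>.\<close>
    moreover have "\<eta> \<subseteq>\<^sub>m \<sigma> \<or> \<sigma> \<subseteq>\<^sub>m \<eta>"
    proof (cases "\<exists>i<len \<eta>. \<sigma> \<subseteq>\<^sub>m \<eta> |` {..<i}")
      case True
      then show ?thesis using restrict_map_le map_le_trans by blast
    next
      case False
      have "\<eta> x = \<sigma> x" if "x \<in> dom \<eta>" for x
      proof -
        have "x < len \<eta>" using that dom_seqs[OF l(2)] by simp
        then have "osucc x < len \<eta>" using olimit_osucc[OF l(1)] by blast
        then have "\<eta> |` {..<osucc x} \<subseteq>\<^sub>m \<sigma>"
          using False l(3)[of "osucc x"] by (auto simp: cone_def)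
        moreover have "x \<in> dom (\<eta> |` {..<osucc x})" using that by simp
        ultimately have "(\<eta> |` {..<osucc x}) x = \<sigma> x" unfolding map_le_def by blast
        then show ?thesis by simp
      qed
      then show ?thesis by (auto simp: map_le_def)
    qed
    ultimately show "\<eta> \<in> ?c" by (simp add: cone_def)
  next
    fix \<eta> :: "'k node"
    assume l: "olimit (len \<eta>)" and \<eta>: "\<eta> \<in> ?c" "\<eta> \<in> seqs"
      and cof: "\<And>i. i < len \<eta> \<Longrightarrow> \<exists>\<nu>\<in>?c. \<nu> \<subseteq>\<^sub>m \<eta> \<and> len \<nu> < len \<eta> \<and> splits ?c \<nu> \<and> i < len \<nu>"
    \<comment> \<open>One splitting node below \<eta> is enough to place \<eta> above \<sigma>, so
      \<open>cof\<close> is taken at \<open>ozero\<close>.\<close>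
    have "ozero < len \<eta>"
      using l ozero_le[of "len \<eta>"] by (auto simp: olimit_def order.order_iff_strict)
    then obtain \<nu> where \<nu>: "\<nu> \<in> ?c" "\<nu> \<subseteq>\<^sub>m \<eta>" "splits ?c \<nu>" using cof by blast
    then have \<sigma>\<eta>: "\<sigma> \<subseteq>\<^sub>m \<eta>" using not_below[OF \<nu>(1,3)] map_le_trans by blast
    have \<eta>p: "\<eta> \<in> p" using \<eta>(1) sub by blast
    have "splits p \<eta>"
    proof (rule PT_limit_splits[OF p l \<eta>p])
      show "\<eta> \<in> seqs_len (len \<eta>)" using \<eta>(2) by (simp add: seqs_len_iff)
      fix i assume "i < len \<eta>"
      then obtain \<nu> where "\<nu> \<in> ?c" "\<nu> \<subseteq>\<^sub>m \<eta>" "len \<nu> < len \<eta>" "splits ?c \<nu>" "i < len \<nu>"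
        using cof by blast
      then show "\<exists>\<nu>\<in>splits_below p \<eta>. i < len \<nu>"
        using splits_below_iff[OF tree_p \<eta>(2)] sub splits_subset[OF sub] by blast
    qed
    then show "splits ?c \<eta>" using splits[OF \<eta>p \<sigma>\<eta>] by simp
  qed
qed

text \<open>A branch of \<open>t\<close> has an initial segment as long as \<sigma>; being
  comparable with \<sigma>, it equals \<sigma>.\<close>

lemma in_if_subset_cone:
  assumes "t \<in> PT f" "t \<subseteq> cone p \<sigma>" "\<sigma> \<in> seqs"
  shows "\<sigma> \<in> t"
proof -
  obtain b where b: "branch t b" using PT_ex_branch[OF assms(1) PT_empty_in[OF assms(1)]] by blast
  let ?\<nu> = "b |` {..<len \<sigma>}"
  have "?\<nu> \<subseteq>\<^sub>m \<sigma> \<or> \<sigma> \<subseteq>\<^sub>m ?\<nu>"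
    using branch_restrict(1)[OF b, of "len \<sigma>"] assms(2) by (auto simp: cone_def)
  then have "?\<nu> = \<sigma>"
    using init_len_eq[OF branch_restrict(2)[OF b] assms(3) _ map_le_refl]
      init_len_eq[OF branch_restrict(2)[OF b] assms(3) map_le_refl]
      branch_restrict(3)[OF b, of "len \<sigma>"] by blast
  then show ?thesis using branch_restrict(1)[OF b, of "len \<sigma>"] by simp
qed

text \<open>Successors of the nodes of level \<open>i\<close> rather than these nodes themselves:
  replacing the tree only from there on leaves the splitting at level \<open>i\<close>
  untouched.\<close>

definition succ_level :: "'k \<Rightarrow> 'k node set \<Rightarrow> 'k node set" where
  "succ_level i p = (\<Union>\<nu>\<in>split_level i p. succs p \<nu>)"

lemma succ_levelE:
  assumes "p \<in> PT f" "\<sigma> \<in> succ_level i p"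
  obtains \<nu> where "\<nu> \<in> p" "\<nu> \<in> seqs" "splits p \<nu>" "ht p \<nu> = i" "\<sigma> \<in> p" "\<sigma> \<in> seqs" "\<nu> \<subseteq>\<^sub>m \<sigma>"
    "len \<sigma> = osucc (len \<nu>)"
proof -
  obtain \<nu> \<alpha> where \<nu>: "\<nu> \<in> split_level i p" "\<sigma> \<in> p" "\<sigma> = snoc \<nu> \<alpha>"
    using assms(2) by (auto simp: succ_level_def succs_def)
  then have \<nu>p: "\<nu> \<in> p" "splits p \<nu>" "ht p \<nu> = i" by (auto simp: split_level_def)
  have \<nu>s: "\<nu> \<in> seqs" using PT_seqs[OF assms(1) \<nu>p(1)] .
  show ?thesis
    using that[OF \<nu>p(1) \<nu>s \<nu>p(2,3) \<nu>(2)] PT_seqs[OF assms(1) \<nu>(2)] \<nu>(3) init_snoc[OF \<nu>s]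
      len_snoc[OF \<nu>s] by simp
qed

text \<open>The two predecessors lie on one path and both split; if their lengths differed, so would
  their heights.\<close>

lemma succ_level_unique:
  assumes p: "p \<in> PT f" and \<sigma>: "\<sigma> \<in> succ_level i p" and \<sigma>': "\<sigma>' \<in> succ_level i p"
    and le: "\<sigma> \<subseteq>\<^sub>m \<eta>" "\<sigma>' \<subseteq>\<^sub>m \<eta>"
  shows "\<sigma> = \<sigma>'"
proof -
  obtain \<nu> where \<nu>: "\<nu> \<in> p" "\<nu> \<in> seqs" "splits p \<nu>" "ht p \<nu> = i" "\<sigma> \<in> p" "\<sigma> \<in> seqs" "\<nu> \<subseteq>\<^sub>m \<sigma>"
    "len \<sigma> = osucc (len \<nu>)" using succ_levelE[OF p \<sigma>] .
  obtain \<nu>' where \<nu>': "\<nu>' \<in> p" "\<nu>' \<in> seqs" "splits p \<nu>'" "ht p \<nu>' = i" "\<sigma>' \<in> p" "\<sigma>' \<in> seqs"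
    "\<nu>' \<subseteq>\<^sub>m \<sigma>'" "len \<sigma>' = osucc (len \<nu>')" using succ_levelE[OF p \<sigma>'] .
  have \<nu>\<eta>: "\<nu> \<subseteq>\<^sub>m \<eta>" "\<nu>' \<subseteq>\<^sub>m \<eta>"
    using map_le_trans[OF \<nu>(7) le(1)] map_le_trans[OF \<nu>'(7) le(2)] by auto
  have "\<not> len \<nu> < len \<nu>'"
  proof
    assume *: "len \<nu> < len \<nu>'"
    then have "\<nu> \<subseteq>\<^sub>m \<nu>'" using init_comparable[OF \<nu>(2) \<nu>'(2) \<nu>\<eta>] by simp
    then show False using ht_less[OF PT_is_tree[OF p] \<nu>'(2) \<nu>(1) _ * \<nu>(3)] \<nu>(4) \<nu>'(4) by simp
  qed
  moreover have "\<not> len \<nu>' < len \<nu>"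
  proof
    assume *: "len \<nu>' < len \<nu>"
    then have "\<nu>' \<subseteq>\<^sub>m \<nu>" using init_comparable[OF \<nu>'(2) \<nu>(2) \<nu>\<eta>(2,1)] by simp
    then show False using ht_less[OF PT_is_tree[OF p] \<nu>(2) \<nu>'(1) _ * \<nu>'(3)] \<nu>(4) \<nu>'(4) by simp
  qed
  ultimately have "len \<nu> = len \<nu>'" by (meson linorder_cases)
  then show ?thesis using init_len_eq[OF \<nu>(6) \<nu>'(6) le] \<nu>(8) \<nu>'(8) by simp
qed

lemma ht_gt_if_above_succ_level:
  assumes p: "p \<in> PT f" and \<sigma>: "\<sigma> \<in> succ_level i p" "\<sigma> \<subseteq>\<^sub>m \<eta>" and \<eta>: "\<eta> \<in> seqs"
  shows "i < ht p \<eta>"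
proof -
  obtain \<nu> where \<nu>: "\<nu> \<in> p" "\<nu> \<in> seqs" "splits p \<nu>" "ht p \<nu> = i" "\<sigma> \<in> p" "\<sigma> \<in> seqs" "\<nu> \<subseteq>\<^sub>m \<sigma>"
    "len \<sigma> = osucc (len \<nu>)" using succ_levelE[OF p \<sigma>(1)] .
  have "len \<nu> < len \<eta>"
    using init_len_le[OF \<nu>(6) \<eta> \<sigma>(2)] \<nu>(8) less_osucc[of "len \<nu>"] by (metis less_le_trans)
  then show ?thesis
    using ht_less[OF PT_is_tree[OF p] \<eta> \<nu>(1) map_le_trans[OF \<nu>(7) \<sigma>(2)] _ \<nu>(3)] \<nu>(4) by blast
qed

text \<open>With \<open>ht_gt_if_above_succ_level\<close>, the nodes of \<open>p\<close> of height
  above \<open>i\<close> are exactly those above a member of \<open>succ_level i p\<close>. This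
  dichotomy organises the amalgamation.\<close>

lemma ex_succ_level_below:
  assumes p: "p \<in> PT f" and \<eta>: "\<eta> \<in> p" "i < ht p \<eta>"
  obtains \<sigma> where "\<sigma> \<in> succ_level i p" "\<sigma> \<subseteq>\<^sub>m \<eta>"
proof -
  have \<eta>s: "\<eta> \<in> seqs" using PT_seqs[OF p \<eta>(1)] .
  obtain \<nu> where \<nu>: "\<nu> \<in> split_level i p" "\<nu> \<subseteq>\<^sub>m \<eta>" "len \<nu> < len \<eta>"
    using ht_lessE[OF PT_is_tree[OF p] \<eta>s \<eta>(2)] .
  have \<nu>s: "\<nu> \<in> seqs" using PT_seqs[OF p] \<nu>(1) by (simp add: split_level_def)
  have "\<eta> |` {..<osucc (len \<nu>)} \<in> succs p \<nu>"
    unfolding succs_def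
    using restrict_osucc_len[OF \<nu>s \<eta>s \<nu>(2,3)] is_tree_restrict[OF PT_is_tree[OF p] \<eta>(1)]
    by blast
  then show ?thesis using that \<nu>(1) restrict_map_le unfolding succ_level_def by blast
qed

section \<open>Fewer than \<kappa> nodes on each splitting level\<close>

lemma card_succs_less:
  assumes "p \<in> PT f" "\<nu> \<in> p"
  shows "|succs p \<nu>| <o |UNIV :: 'k set|"
proof (rule card_subset_less)
  show "succs p \<nu> \<subseteq> snoc \<nu> ` {..<f (len \<nu>)}"
  proof
    fix \<sigma> assume "\<sigma> \<in> succs p \<nu>"
    then obtain \<alpha> where \<alpha>: "\<sigma> = snoc \<nu> \<alpha>" "\<sigma> \<in> p" by (auto simp: succs_def)
    have "len \<nu> \<in> dom \<sigma>" using \<alpha>(1) by (simp add: snoc_def)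
    then have "the (\<sigma> (len \<nu>)) < f (len \<nu>)" using PT_bound[OF assms(1) \<alpha>(2)] by blast
    then have "\<alpha> < f (len \<nu>)" using \<alpha>(1) by (simp add: snoc_def)
    then show "\<sigma> \<in> snoc \<nu> ` {..<f (len \<nu>)}" using \<alpha>(1) by blast
  qed
  show "|snoc \<nu> ` {..<f (len \<nu>)}| <o |UNIV :: 'k set|"
    by (rule card_image_less[OF card_lessThan_less])
qed

lemma card_succ_level_if_split_level:
  assumes "p \<in> PT f" "|split_level i p| <o |UNIV :: 'k set|"
  shows "|succ_level i p| <o |UNIV :: 'k set|"
  unfolding succ_level_def
proof (rule stable_UNION[OF stable_kappa assms(2)])
  fix \<nu> assume "\<nu> \<in> split_level i p"
  then show "|succs p \<nu>| <o |UNIV :: 'k set|"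
    using card_succs_less[OF assms(1)] by (simp add: split_level_def)
qed

text \<open>A node of \<open>split_level i p\<close> is determined by the choices it makes at the splitting nodes below it.\<close>

lemma split_level_inj:
  assumes p: "p \<in> PT f" and \<eta>: "\<eta> \<in> split_level i p" and \<eta>': "\<eta>' \<in> split_level i p"
    and same: "\<And>j \<sigma>. j < i \<Longrightarrow> \<sigma> \<in> succ_level j p \<Longrightarrow> \<sigma> \<subseteq>\<^sub>m \<eta> \<Longrightarrow> \<sigma> \<subseteq>\<^sub>m \<eta>'"
    and len: "len \<eta> \<le> len \<eta>'"
  shows "\<eta> = \<eta>'"
proof -
  note tree = PT_is_tree[OF p]
  have \<eta>p: "\<eta> \<in> p" "splits p \<eta>" "ht p \<eta> = i" and \<eta>'p: "\<eta>' \<in> p" "splits p \<eta>'" "ht p \<eta>' = i"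
    using \<eta> \<eta>' by (auto simp: split_level_def)
  have s: "\<eta> \<in> seqs" "\<eta>' \<in> seqs" using PT_seqs[OF p] \<eta>p \<eta>'p by auto
  have "\<eta> x = \<eta>' x" if "x < len \<eta>" for x
    using that
  proof (induction x rule: less_induct)
    case (less x)
    show ?case
    proof (rule ccontr)
      assume ne: "\<eta> x \<noteq> \<eta>' x"
      let ?\<nu> = "\<eta> |` {..<x}"
      have eq: "?\<nu> = \<eta>' |` {..<x}"
        using less by (auto simp: restrict_map_def fun_eq_iff)
      have d: "{..<osucc x} \<subseteq> dom \<eta>" "{..<osucc x} \<subseteq> dom \<eta>'"
        using dom_seqs[OF s(1)] dom_seqs[OF s(2)] osucc_le[OF less.prems] len by auto
      have sp: "splits p ?\<nu>"
        using splits_at_difference[OF is_tree_restrict[OF tree \<eta>p(1)]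
            is_tree_restrict[OF tree \<eta>'p(1)] d eq ne] .
      have \<nu>: "?\<nu> \<in> p" "?\<nu> \<in> seqs" "len ?\<nu> = x"
        using is_tree_restrict[OF tree \<eta>p(1)] seqs_restrict[OF s(1), of x] less.prems by auto
      have lt: "ht p ?\<nu> < i"
        using ht_less[OF tree s(1) \<nu>(1) restrict_map_le _ sp] \<nu>(3) less.prems \<eta>p(3) by simp
      have "\<eta> |` {..<osucc x} \<in> succs p ?\<nu>"
        unfolding succs_def
        using restrict_osucc[OF d(1)] is_tree_restrict[OF tree \<eta>p(1)] by blast
      then have "\<eta> |` {..<osucc x} \<in> succ_level (ht p ?\<nu>) p"
        using \<nu>(1) sp by (auto simp: succ_level_def split_level_def)
      then have "\<eta> |` {..<osucc x} \<subseteq>\<^sub>m \<eta>'" using same[OF lt] restrict_map_le by blast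
      moreover have "x \<in> dom (\<eta> |` {..<osucc x})"
        using d(1) by (auto simp: lessThan_osucc)
      ultimately have "(\<eta> |` {..<osucc x}) x = \<eta>' x" unfolding map_le_def by blast
      then show False using ne by simp
    qed
  qed
  then have le: "\<eta> \<subseteq>\<^sub>m \<eta>'" using dom_seqs[OF s(1)] by (auto simp: map_le_def)
  \<comment> \<open>As \<eta> splits, a proper extension of it has strictly larger height, whereas
    both nodes have height \<open>i\<close>.\<close>
  have "\<not> len \<eta> < len \<eta>'"
    using ht_less[OF tree s(2) \<eta>p(1) le _ \<eta>p(2)] \<eta>p(3) \<eta>'p(3) by auto
  then show ?thesis using init_len_eq[OF s le map_le_refl] len by simp
qed

text \<open>Strong induction serves successor and limit levels alike. Regularity makes the union of
  the earlier successor levels small, and the strong limit property does the same for its power set,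
  in which the codes lie.\<close>

lemma card_split_level_less:
  assumes p: "p \<in> PT f"
  shows "|split_level i p| <o |UNIV :: 'k set|"
proof (induction i rule: less_induct)
  case (less i)
  let ?V = "\<Union>j\<in>{..<i}. succ_level j p"
  let ?g = "\<lambda>\<eta>. {\<sigma> \<in> ?V. \<sigma> \<subseteq>\<^sub>m \<eta>}"
  have "|succ_level j p| <o |UNIV :: 'k set|" if "j \<in> {..<i}" for j
    using card_succ_level_if_split_level[OF p less.IH] that by simp
  then have "|?V| <o |UNIV :: 'k set|"
    by (rule stable_UNION[OF stable_kappa card_lessThan_less])
  then have V: "|Pow ?V| <o |UNIV :: 'k set|" by (rule card_Pow_less)
  have "inj_on ?g (split_level i p)"
  proof (rule inj_onI)
    fix \<eta> \<eta>' assume *: "\<eta> \<in> split_level i p" "\<eta>' \<in> split_level i p" "?g \<eta> = ?g \<eta>'"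
    then have same: "\<sigma> \<subseteq>\<^sub>m \<eta> \<longleftrightarrow> \<sigma> \<subseteq>\<^sub>m \<eta>'" if "j < i" "\<sigma> \<in> succ_level j p" for j \<sigma>
      using that by blast
    show "\<eta> = \<eta>'"
    proof (cases "len \<eta> \<le> len \<eta>'")
      case True
      then show ?thesis using split_level_inj[OF p *(1,2)] same by blast
    next
      case False
      then have "len \<eta>' \<le> len \<eta>" by simp
      then have "\<eta>' = \<eta>" using split_level_inj[OF p *(2,1)] same by blast
      then show ?thesis ..
    qed
  qed
  then have "|split_level i p| =o |?g ` split_level i p|"
    by (meson card_of_ordIsoI inj_on_imp_bij_betw)
  moreover have "|?g ` split_level i p| <o |UNIV :: 'k set|"
    by (rule card_subset_less[OF _ V]) blast
  ultimately show ?case by (rule ordIso_ordLess_trans)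
qed

lemma card_succ_level_less: "p \<in> PT f \<Longrightarrow> |succ_level i p| <o |UNIV :: 'k set|"
  using card_succ_level_if_split_level card_split_level_less by blast

section \<open>Amalgamation above the successors of a splitting level\<close>

definition amalgam :: "'k \<Rightarrow> 'k node set \<Rightarrow> ('k node \<Rightarrow> 'k node set) \<Rightarrow> 'k node set" where
  "amalgam i p Q = {\<eta> \<in> p. \<forall>\<sigma>\<in>succ_level i p. \<sigma> \<subseteq>\<^sub>m \<eta> \<longrightarrow> \<eta> \<in> Q \<sigma>}"

context
  fixes p :: "'k node set" and i :: 'k and Q :: "'k node \<Rightarrow> 'k node set"
  assumes p: "p \<in> PT f"
    and Q_all: "\<forall>\<sigma>\<in>succ_level i p. Q \<sigma> \<in> PT f \<and> Q \<sigma> \<subseteq> cone p \<sigma>"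
begin

lemma Q: "\<sigma> \<in> succ_level i p \<Longrightarrow> Q \<sigma> \<in> PT f"
  and Q_cone: "\<sigma> \<in> succ_level i p \<Longrightarrow> Q \<sigma> \<subseteq> cone p \<sigma>"
  using Q_all by blast+

lemma succ_level_in_p: "\<sigma> \<in> succ_level i p \<Longrightarrow> \<sigma> \<in> p"
  by (auto simp: succ_level_def succs_def)

lemma succ_level_in_Q: "\<sigma> \<in> succ_level i p \<Longrightarrow> \<sigma> \<in> Q \<sigma>"
  using in_if_subset_cone[OF Q Q_cone] PT_seqs[OF p succ_level_in_p] by blast

lemma Q_subset: "\<sigma> \<in> succ_level i p \<Longrightarrow> Q \<sigma> \<subseteq> p"
  using Q_cone by (auto simp: cone_def)

lemma amalgam_subset: "amalgam i p Q \<subseteq> p"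
  by (auto simp: amalgam_def)

text \<open>Members of \<open>succ_level i p\<close> below the same node coincide, so the quantifier
  in \<open>amalgam\<close> concerns just one tree.\<close>

lemma amalgam_iff_above:
  assumes "\<sigma> \<in> succ_level i p" "\<sigma> \<subseteq>\<^sub>m \<eta>"
  shows "\<eta> \<in> amalgam i p Q \<longleftrightarrow> \<eta> \<in> Q \<sigma>"
proof -
  have "\<sigma>' = \<sigma>" if "\<sigma>' \<in> succ_level i p" "\<sigma>' \<subseteq>\<^sub>m \<eta>" for \<sigma>'
    using succ_level_unique[OF p that(1) assms(1) that(2) assms(2)] .
  then show ?thesis using assms Q_subset[OF assms(1)] unfolding amalgam_def by blast
qed

lemma amalgam_low: "\<eta> \<in> p \<Longrightarrow> ht p \<eta> \<le> i \<Longrightarrow> \<eta> \<in> amalgam i p Q"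
  using ht_gt_if_above_succ_level[OF p _ _ PT_seqs[OF p]] unfolding amalgam_def
  by (blast dest: leD)

lemma succs_amalgam_above:
  assumes "\<sigma> \<in> succ_level i p" "\<sigma> \<subseteq>\<^sub>m \<eta>" "\<eta> \<in> seqs"
  shows "succs (amalgam i p Q) \<eta> = succs (Q \<sigma>) \<eta>"
proof -
  have "snoc \<eta> \<alpha> \<in> amalgam i p Q \<longleftrightarrow> snoc \<eta> \<alpha> \<in> Q \<sigma>" for \<alpha>
    using amalgam_iff_above[OF assms(1) map_le_trans[OF assms(2) init_snoc[OF assms(3)]]] .
  then show ?thesis by (auto simp: succs_def)
qed

text \<open>A node \<open>snoc \<eta> \<alpha>\<close> can lie above a member \<sigma> of
  \<open>succ_level i p\<close> only by being equal to it, and each such \<sigma> lies in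
  \<open>Q \<sigma>\<close>.\<close>

lemma succs_amalgam_below:
  assumes "\<eta> \<in> p" "ht p \<eta> \<le> i"
  shows "succs (amalgam i p Q) \<eta> = succs p \<eta>"
proof -
  have \<eta>s: "\<eta> \<in> seqs" using PT_seqs[OF p assms(1)] .
  have "snoc \<eta> \<alpha> \<in> amalgam i p Q" if *: "snoc \<eta> \<alpha> \<in> p" for \<alpha>
    unfolding amalgam_def
  proof (intro CollectI conjI ballI impI *)
    fix \<sigma> assume \<sigma>: "\<sigma> \<in> succ_level i p" "\<sigma> \<subseteq>\<^sub>m snoc \<eta> \<alpha>"
    have \<sigma>s: "\<sigma> \<in> seqs" using PT_seqs[OF p succ_level_in_p[OF \<sigma>(1)]] .
    have "\<not> \<sigma> \<subseteq>\<^sub>m \<eta>" using ht_gt_if_above_succ_level[OF p \<sigma>(1) _ \<eta>s] assms(2) by (auto simp: leD)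
    then have "\<not> len \<sigma> \<le> len \<eta>" using init_comparable[OF \<sigma>s \<eta>s \<sigma>(2) init_snoc[OF \<eta>s]] by blast
    then have "osucc (len \<eta>) \<le> len \<sigma>" by (simp add: osucc_le)
    moreover have "len \<sigma> \<le> osucc (len \<eta>)"
      using init_len_le[OF \<sigma>s snoc_seqs[OF \<eta>s] \<sigma>(2)] len_snoc[OF \<eta>s] by simp
    ultimately have "\<sigma> = snoc \<eta> \<alpha>"
      using init_len_eq[OF \<sigma>s snoc_seqs[OF \<eta>s] \<sigma>(2) map_le_refl] len_snoc[OF \<eta>s] by simp
    then show "snoc \<eta> \<alpha> \<in> Q \<sigma>" using succ_level_in_Q[OF \<sigma>(1)] by simp
  qed
  then show ?thesis using amalgam_subset by (auto simp: succs_def)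
qed

lemma amalgam_cases:
  assumes "\<eta> \<in> p"
  obtains "ht p \<eta> \<le> i" | \<sigma> where "\<sigma> \<in> succ_level i p" "\<sigma> \<subseteq>\<^sub>m \<eta>"
proof (cases "ht p \<eta> \<le> i")
  case True
  then show ?thesis by (rule that(1))
next
  case False
  then have "i < ht p \<eta>" by simp
  then obtain \<sigma> where "\<sigma> \<in> succ_level i p" "\<sigma> \<subseteq>\<^sub>m \<eta>"
    by (rule ex_succ_level_below[OF p assms])
  then show ?thesis by (rule that(2))
qed

text \<open>Locally each node looks like a node of \<open>p\<close>, if its height is at most
  \<open>i\<close>, or of a single \<open>Q \<sigma>\<close>, and inherits every clause from that
  tree. At limit lengths \<sigma> is strictly shorter, because its own length is a successor, so all
  sufficiently long initial segments already lie above it.\<close>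

lemma amalgam_in_PT: "amalgam i p Q \<in> PT f"
proof -
  let ?q = "amalgam i p Q"
  note tree_p = PT_is_tree[OF p]
  have seqs: "\<eta> \<in> seqs" if "\<eta> \<in> ?q" for \<eta> using that amalgam_subset PT_seqs[OF p] by blast
  have tree: "is_tree ?q"
    unfolding is_tree_def
  proof (intro conjI ballI impI)
    show "?q \<subseteq> seqs" using seqs by blast
    fix \<eta> \<nu> assume *: "\<eta> \<in> ?q" "\<nu> \<in> seqs" "\<nu> \<subseteq>\<^sub>m \<eta>"
    have "\<nu> \<in> p" using is_tree_init[OF tree_p] * amalgam_subset by blast
    moreover have "\<nu> \<in> Q \<sigma>" if \<sigma>: "\<sigma> \<in> succ_level i p" "\<sigma> \<subseteq>\<^sub>m \<nu>" for \<sigma>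
    proof -
      have "\<eta> \<in> Q \<sigma>"
        using amalgam_iff_above[OF \<sigma>(1) map_le_trans[OF \<sigma>(2) *(3)]] *(1) by simp
      then show ?thesis using is_tree_init[OF PT_is_tree[OF Q[OF \<sigma>(1)]] _ *(2,3)] by blast
    qed
    ultimately show "\<nu> \<in> ?q" by (simp add: amalgam_def)
  qed
  have above_ex: "\<exists>\<nu>\<in>?q. \<eta> \<subseteq>\<^sub>m \<nu> \<and> splits ?q \<nu>"
    if \<eta>: "\<eta> \<in> ?q" and \<sigma>: "\<sigma> \<in> succ_level i p" "\<sigma> \<subseteq>\<^sub>m \<eta>" for \<eta> \<sigma>
  proof -
    have "\<eta> \<in> Q \<sigma>" using amalgam_iff_above[OF \<sigma>] \<eta> by simp
    then obtain \<nu> where \<nu>: "\<nu> \<in> Q \<sigma>" "\<eta> \<subseteq>\<^sub>m \<nu>" "splits (Q \<sigma>) \<nu>"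
      using PT_ex_splits[OF Q[OF \<sigma>(1)]] by blast
    have \<sigma>\<nu>: "\<sigma> \<subseteq>\<^sub>m \<nu>" using map_le_trans[OF \<sigma>(2) \<nu>(2)] .
    then have "\<nu> \<in> ?q" using amalgam_iff_above[OF \<sigma>(1)] \<nu>(1) by simp
    moreover have "splits ?q \<nu>"
      using splits_cong[OF succs_amalgam_above[OF \<sigma>(1) \<sigma>\<nu> seqs[OF \<open>\<nu> \<in> ?q\<close>]]] \<nu>(3) by simp
    ultimately show ?thesis using \<nu>(2) by blast
  qed
  show ?thesis
  proof (rule PT_I[OF tree])
    have "ht p Map.empty \<le> len (Map.empty :: 'k node)"
      using ht_le_len[OF tree_p PT_seqs[OF p PT_empty_in[OF p]]] .
    moreover have "len (Map.empty :: 'k node) = ozero" by (rule len_eqI) simp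
    ultimately have "ht p Map.empty \<le> i" using ozero_le order_trans by metis
    then show "Map.empty \<in> ?q" using amalgam_low[OF PT_empty_in[OF p]] by blast
    show "the (\<eta> j) < f j" if "\<eta> \<in> ?q" "j \<in> dom \<eta>" for \<eta> j
      using that amalgam_subset PT_bound[OF p] by blast
    show "(\<exists>!\<nu>. \<nu> \<in> succs ?q \<eta>) \<or> succs ?q \<eta> = full_succs \<eta>" if \<eta>: "\<eta> \<in> ?q" for \<eta>
    proof -
      have \<eta>p: "\<eta> \<in> p" using \<eta> amalgam_subset by blast
      then show ?thesis
      proof (cases rule: amalgam_cases)
        case 1
        then show ?thesis using PT_succs[OF p \<eta>p] succs_amalgam_below[OF \<eta>p] by simp
      next
        case (2 \<sigma>)
        have "\<eta> \<in> Q \<sigma>" using amalgam_iff_above[OF 2] \<eta> by simp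
        then show ?thesis
          using PT_succs[OF Q[OF 2(1)]] succs_amalgam_above[OF 2 seqs[OF \<eta>]] by simp
      qed
    qed
    show "\<exists>\<nu>\<in>?q. \<eta> \<subseteq>\<^sub>m \<nu> \<and> splits ?q \<nu>" if \<eta>: "\<eta> \<in> ?q" for \<eta>
    proof -
      have \<eta>p: "\<eta> \<in> p" using \<eta> amalgam_subset by blast
      then show ?thesis
      proof (cases rule: amalgam_cases)
        case 1
        obtain \<nu> where \<nu>: "\<nu> \<in> split_level i p" "\<eta> \<subseteq>\<^sub>m \<nu>"
          using ex_split_level_above[OF p \<eta>p 1] .
        then have \<nu>p: "\<nu> \<in> p" "splits p \<nu>" "ht p \<nu> \<le> i" by (auto simp: split_level_def)
        have "splits ?q \<nu>" using splits_cong[OF succs_amalgam_below[OF \<nu>p(1,3)]] \<nu>p(2) by simp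
        then show ?thesis using amalgam_low[OF \<nu>p(1,3)] \<nu>(2) by blast
      next
        case (2 \<sigma>)
        then show ?thesis using above_ex[OF \<eta>] by blast
      qed
    qed
  next
    fix \<eta> :: "'k node"
    assume l: "olimit (len \<eta>)" "\<eta> \<in> seqs" "\<And>j. j < len \<eta> \<Longrightarrow> \<eta> |` {..<j} \<in> ?q"
    have "\<eta> \<in> p"
      using PT_limit_in[OF p l(1)] l(2,3) amalgam_subset by (auto simp: seqs_len_iff)
    moreover have "\<eta> \<in> Q \<sigma>" if \<sigma>: "\<sigma> \<in> succ_level i p" "\<sigma> \<subseteq>\<^sub>m \<eta>" for \<sigma>
    proof -
      note QPT = Q[OF \<sigma>(1)]
      obtain \<nu> where \<nu>: "\<sigma> \<in> seqs" "len \<sigma> = osucc (len \<nu>)" using succ_levelE[OF p \<sigma>(1)] by metis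
      have "len \<sigma> \<noteq> len \<eta>" using \<nu>(2) l(1) not_olimit_osucc[of "len \<nu>"] by metis
      then have lt: "len \<sigma> < len \<eta>" using init_len_le[OF \<nu>(1) l(2) \<sigma>(2)] by simp
      have "\<eta> |` {..<j} \<in> Q \<sigma>" if j: "j < len \<eta>" for j
      proof -
        \<comment> \<open>Membership in the amalgam says nothing about \<open>Q \<sigma>\<close> for
          segments shorter than \<sigma>, so it is read off at a length of at least
          \<open>len \<sigma>\<close> and then restricted.\<close>
        define m where "m = max j (len \<sigma>)"
        have m: "m < len \<eta>" "len \<sigma> \<le> m" "j \<le> m" using j lt by (auto simp: m_def)
        have "\<sigma> \<subseteq>\<^sub>m \<eta> |` {..<m}"
          using init_eq_restrict[OF \<nu>(1) \<sigma>(2)] restrict_le_restrict[OF m(2), of \<eta>] by simp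
        then have "\<eta> |` {..<m} \<in> Q \<sigma>" using amalgam_iff_above[OF \<sigma>(1)] l(3)[OF m(1)] by blast
        moreover have "\<eta> |` {..<j} \<in> seqs" using seqs_restrict(1)[OF l(2), of j] j by simp
        ultimately show ?thesis
          using is_tree_init[OF PT_is_tree[OF QPT]] restrict_le_restrict[OF m(3), of \<eta>] by blast
      qed
      then show ?thesis using PT_limit_in[OF QPT l(1)] l(2) by (auto simp: seqs_len_iff)
    qed
    ultimately show "\<eta> \<in> ?q" by (simp add: amalgam_def)
  next
    fix \<eta> :: "'k node"
    assume l: "olimit (len \<eta>)" and \<eta>: "\<eta> \<in> ?q" "\<eta> \<in> seqs"
      and cof: "\<And>j. j < len \<eta> \<Longrightarrow> \<exists>\<nu>\<in>?q. \<nu> \<subseteq>\<^sub>m \<eta> \<and> len \<nu> < len \<eta> \<and> splits ?q \<nu> \<and> j < len \<nu>"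
    have \<eta>p: "\<eta> \<in> p" using \<eta>(1) amalgam_subset by blast
    have \<eta>l: "\<eta> \<in> seqs_len (len \<eta>)" using \<eta>(2) by (simp add: seqs_len_iff)
    from \<eta>p show "splits ?q \<eta>"
    proof (cases rule: amalgam_cases)
      case 1
      have "splits p \<eta>"
      proof (rule PT_limit_splits[OF p l \<eta>p \<eta>l])
        fix j assume "j < len \<eta>"
        then obtain \<nu> where "\<nu> \<in> ?q" "\<nu> \<subseteq>\<^sub>m \<eta>" "len \<nu> < len \<eta>" "splits ?q \<nu>" "j < len \<nu>"
          using cof by blast
        then show "\<exists>\<nu>\<in>splits_below p \<eta>. j < len \<nu>"
          using splits_below_iff[OF tree_p \<eta>(2)] amalgam_subset splits_subset[OF amalgam_subset]
          by blast
      qed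
      then show ?thesis using splits_cong[OF succs_amalgam_below[OF \<eta>p 1]] by simp
    next
      case (2 \<sigma>)
      note QPT = Q[OF 2(1)]
      have \<eta>Q: "\<eta> \<in> Q \<sigma>" using amalgam_iff_above[OF 2] \<eta>(1) by simp
      obtain \<nu>\<^sub>0 where \<sigma>: "\<sigma> \<in> seqs" "len \<sigma> = osucc (len \<nu>\<^sub>0)"
        using succ_levelE[OF p 2(1)] by metis
      have "len \<sigma> \<noteq> len \<eta>" using \<sigma>(2) l not_olimit_osucc[of "len \<nu>\<^sub>0"] by metis
      then have lt: "len \<sigma> < len \<eta>" using init_len_le[OF \<sigma>(1) \<eta>(2) 2(2)] by simp
      have "splits (Q \<sigma>) \<eta>"
      proof (rule PT_limit_splits[OF QPT l \<eta>Q \<eta>l])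
        fix j assume "j < len \<eta>"
        \<comment> \<open>The maximum asks for splitting nodes long enough to extend \<sigma>, where
          the amalgam and \<open>Q \<sigma>\<close> have the same successors.\<close>
        then have "max j (len \<sigma>) < len \<eta>" using lt by simp
        then obtain \<nu> where \<nu>: "\<nu> \<in> ?q" "\<nu> \<subseteq>\<^sub>m \<eta>" "len \<nu> < len \<eta>" "splits ?q \<nu>" "max j (len \<sigma>) < len \<nu>"
          using cof by blast
        then have len: "len \<sigma> \<le> len \<nu>" "j < len \<nu>" by auto
        have \<sigma>\<nu>: "\<sigma> \<subseteq>\<^sub>m \<nu>" using init_comparable[OF \<sigma>(1) seqs[OF \<nu>(1)] 2(2) \<nu>(2) len(1)] .
        have "\<nu> \<in> Q \<sigma>" using amalgam_iff_above[OF 2(1) \<sigma>\<nu>] \<nu>(1) by simp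
        moreover have "splits (Q \<sigma>) \<nu>"
          using splits_cong[OF succs_amalgam_above[OF 2(1) \<sigma>\<nu> seqs[OF \<nu>(1)]]] \<nu>(4) by simp
        ultimately show "\<exists>\<nu>\<in>splits_below (Q \<sigma>) \<eta>. j < len \<nu>"
          using splits_below_iff[OF PT_is_tree[OF QPT] \<eta>(2)] \<nu>(2,3) len(2) by blast
      qed
      then show ?thesis using splits_cong[OF succs_amalgam_above[OF 2 \<eta>(2)]] by simp
    qed
  qed
qed

lemma amalgam_le: "PT_le_at i (amalgam i p Q) p"
  unfolding PT_le_at_iff[OF p amalgam_in_PT] using amalgam_subset amalgam_low by blast

text \<open>A node of height above \<open>i\<close> in \<open>s\<close> has at least that height in
  \<open>p\<close>, so it runs through some \<sigma>; from \<sigma> on, \<open>s\<close> is confined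
  to \<open>Q \<sigma>\<close>.\<close>

lemma ex_cone_below_amalgam:
  assumes s: "s \<in> PT f" "s \<subseteq> amalgam i p Q"
  obtains \<sigma> where "\<sigma> \<in> succ_level i p" "\<sigma> \<in> s" "cone s \<sigma> \<subseteq> Q \<sigma>"
proof -
  have sp: "s \<subseteq> p" using s(2) amalgam_subset by blast
  have "ht s Map.empty \<le> len (Map.empty :: 'k node)"
    using ht_le_len[OF PT_is_tree[OF s(1)] PT_seqs[OF s(1) PT_empty_in[OF s(1)]]] .
  moreover have "len (Map.empty :: 'k node) = ozero" by (rule len_eqI) simp
  ultimately have "ht s Map.empty \<le> osucc i" using ozero_le order_trans by metis
  then obtain \<tau> where "\<tau> \<in> split_level (osucc i) s"
    using ex_split_level_above[OF s(1) PT_empty_in[OF s(1)]] by blast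
  then have \<tau>: "\<tau> \<in> s" "ht s \<tau> = osucc i" by (auto simp: split_level_def)
  have \<tau>s: "\<tau> \<in> seqs" using PT_seqs[OF s(1) \<tau>(1)] .
  have "osucc i \<le> ht p \<tau>"
    using ht_subset[OF PT_is_tree[OF p] PT_is_tree[OF s(1)] sp \<tau>s] \<tau>(2) by simp
  then have "i < ht p \<tau>" using less_osucc[of i] by order
  then obtain \<sigma> where \<sigma>: "\<sigma> \<in> succ_level i p" "\<sigma> \<subseteq>\<^sub>m \<tau>"
    using ex_succ_level_below[OF p] sp \<tau>(1) by blast
  have \<sigma>s: "\<sigma> \<in> seqs" using PT_seqs[OF p succ_level_in_p[OF \<sigma>(1)]] .
  have "\<sigma> \<in> s" using is_tree_init[OF PT_is_tree[OF s(1)] \<tau>(1) \<sigma>s \<sigma>(2)] .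
  moreover have "cone s \<sigma> \<subseteq> Q \<sigma>"
  proof
    fix \<eta> assume "\<eta> \<in> cone s \<sigma>"
    then have \<eta>: "\<eta> \<in> s" "\<eta> \<subseteq>\<^sub>m \<sigma> \<or> \<sigma> \<subseteq>\<^sub>m \<eta>" by (auto simp: cone_def)
    from \<eta>(2) show "\<eta> \<in> Q \<sigma>"
    proof
      assume "\<eta> \<subseteq>\<^sub>m \<sigma>"
      then show ?thesis
        using is_tree_init[OF PT_is_tree[OF Q[OF \<sigma>(1)]] succ_level_in_Q[OF \<sigma>(1)]]
          PT_seqs[OF s(1) \<eta>(1)] by blast
    next
      assume "\<sigma> \<subseteq>\<^sub>m \<eta>"
      then show ?thesis using amalgam_iff_above[OF \<sigma>(1)] \<eta>(1) s(2) by blast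
    qed
  qed
  ultimately show ?thesis using that \<sigma>(1) by blast
qed

end

section \<open>Antichains\<close>

text \<open>Maximality under inclusion in the form in which it is applied: a condition incompatible
  with every element of \<open>A\<close> could be added to it.\<close>

lemma maximal_antichain_compatible:
  assumes A: "maximal_antichain (PT f) PT_le A" and t: "t \<in> PT f"
  obtains r where "r \<in> A" "compatible (PT f) PT_le r t"
proof (cases "t \<in> A")
  case True
  then show ?thesis using that t by (auto simp: compatible_def PT_le_def)
next
  case False
  have anti: "antichain (PT f) PT_le A"
    and max: "\<And>B. antichain (PT f) PT_le B \<Longrightarrow> A \<subseteq> B \<Longrightarrow> B = A"
    using A by (auto simp: maximal_antichain_def)
  have "\<not> antichain (PT f) PT_le (insert t A)" using max[of "insert t A"] False by blast
  then obtain r where "r \<in> A" "compatible (PT f) PT_le r t"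
    using anti t unfolding antichain_def compatible_def by blast
  then show ?thesis using that by blast
qed

lemma small_antichain_trace:
  assumes A: "maximal_antichain (PT f) PT_le A" and p: "p \<in> PT f"
  shows "\<exists>q\<in>PT f. PT_le_at i q p \<and> |{r \<in> A. compatible (PT f) PT_le r q}| <o |UNIV :: 'k set|"
proof -
  have "\<exists>r t. r \<in> A \<and> t \<in> PT f \<and> t \<subseteq> cone p \<sigma> \<and> t \<subseteq> r" if \<sigma>: "\<sigma> \<in> succ_level i p" for \<sigma>
  proof -
    have "\<sigma> \<in> p" using \<sigma> by (auto simp: succ_level_def succs_def)
    then have "cone p \<sigma> \<in> PT f" by (rule cone_in_PT[OF p])
    then obtain r where "r \<in> A" "compatible (PT f) PT_le r (cone p \<sigma>)"
      using maximal_antichain_compatible[OF A] by blast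
    then show ?thesis unfolding compatible_def PT_le_def by blast
  qed
  then obtain R Q where RQ: "\<And>\<sigma>. \<sigma> \<in> succ_level i p \<Longrightarrow>
      R \<sigma> \<in> A \<and> Q \<sigma> \<in> PT f \<and> Q \<sigma> \<subseteq> cone p \<sigma> \<and> Q \<sigma> \<subseteq> R \<sigma>" by metis
  then have Q: "\<forall>\<sigma>\<in>succ_level i p. Q \<sigma> \<in> PT f \<and> Q \<sigma> \<subseteq> cone p \<sigma>" by blast
  let ?q = "amalgam i p Q"
  have "{r \<in> A. compatible (PT f) PT_le r ?q} \<subseteq> R ` succ_level i p"
  proof
    fix r assume "r \<in> {r \<in> A. compatible (PT f) PT_le r ?q}"
    then obtain s where r: "r \<in> A" and s: "s \<in> PT f" "s \<subseteq> r" "s \<subseteq> ?q"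
      by (auto simp: compatible_def PT_le_def)
    obtain \<sigma> where \<sigma>: "\<sigma> \<in> succ_level i p" "\<sigma> \<in> s" "cone s \<sigma> \<subseteq> Q \<sigma>"
      using ex_cone_below_amalgam[OF p Q s(1,3)] .
    \<comment> \<open>The condition \<open>cone s \<sigma>\<close> lies below both \<open>r\<close>
      and \<open>R \<sigma>\<close>, which forces these elements of the antichain to be
      equal.\<close>
    have "cone s \<sigma> \<in> PT f" using cone_in_PT[OF s(1) \<sigma>(2)] .
    moreover have "cone s \<sigma> \<subseteq> r" using s(2) by (auto simp: cone_def)
    moreover have "cone s \<sigma> \<subseteq> R \<sigma>" using \<sigma>(3) RQ[OF \<sigma>(1)] by blast
    ultimately have "compatible (PT f) PT_le r (R \<sigma>)" by (auto simp: compatible_def PT_le_def)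
    then have "r = R \<sigma>"
      using A r RQ[OF \<sigma>(1)] unfolding maximal_antichain_def antichain_def by blast
    then show "r \<in> R ` succ_level i p" using \<sigma>(1) by blast
  qed
  then have "|{r \<in> A. compatible (PT f) PT_le r ?q}| <o |UNIV :: 'k set|"
    by (rule card_subset_less[OF _ card_image_less[OF card_succ_level_less[OF p]]])
  then show ?thesis using amalgam_in_PT[OF p Q] amalgam_le[OF p Q] by blast
qed

end

theorem theorem12:
  fixes f :: "'k::wellorder \<Rightarrow> 'k"
  assumes "inaccessible (ord_rel :: 'k rel)"
    and "strict_mono f"
    and "f ozero > osucc ozero"
  shows "strongly_bounding_via (PT f) PT_le PT_le_at"
proof -
  interpret inaccessible_tree f by unfold_locales (fact assms)+
  show ?thesis
    unfolding strongly_bounding_via_def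
  proof (intro conjI allI impI ballI)
    show "forcing (PT f) PT_le"
      unfolding forcing_def PT_le_def
      using full_tree_in_PT by (auto intro: reflp_onI transp_onI)
    show "reflp_on (PT f) (PT_le_at i)" for i
      by (rule reflp_onI) (auto simp: PT_le_at_def PT_le_def split_level_def)
    show "transp_on (PT f) (PT_le_at i)" for i
      by (rule transp_onI) (rule PT_le_at_trans)
    show "PT_le q p" if "PT_le_at i q p" for i p q
      using that by (simp add: PT_le_at_def)
    show "PT_le_at j q p" if "j < i" "p \<in> PT f" "q \<in> PT f" "PT_le_at i q p" for i j p q
      using PT_le_at_mono[OF that(2,3,4)] that(1) by simp
    show "\<exists>q\<in>PT f. \<forall>j\<in>I. PT_le_at j q (p j)"
      if "le_kappa_index I \<and> fusion_seq (PT f) PT_le_at I p" for I p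
      using fusion_PT that by blast
  qed (use lt_closed_PT small_antichain_trace in blast)+
qed

end
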